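(* Consider the $T$-period setting described in the context. Assume: (Irreversible treatment) For all $t\in\mathcal{T}\setminus\{T\}$, $D_{i,t}=1\implies D_{i,t+1}=1$. (Exclusion) For each $t\in\mathcal{T}$ and $z\in\{0,1\}$, $Y_{i,t}(0,z)=Y_{i,t}(0)$ and $Y_{i,t}(1,\tau,z)=Y_{i,t}(1,\tau)$ for all $\tau\in\{0,\dots,t-1\}$ (that is, potential outcomes do not depend on $z$). (Independence) For all $t\in\mathcal{T}$, $\big(Y_{i,t}(0),Y_{i,t}(1,0),\dots,Y_{i,t}(1,t-1),D_{i,1}(1),D_{i,1}(0),\dots,D_{i,t}(1),D_{i,t}(0)\big)$ is independent of $Z_i$. (Relevance at $t=1$) $FS_1\neq 0$. (Monotonicity at $t=1$) $\mathbb{P}(F_1)=0$. Let $t\in\mathcal{T}\setminus\{1\}$ and suppose there exist $\underline{\Delta}_t,\overline{\Delta}_t\in\mathbb{R}$, with $\underline{\Delta}_t\le 0\le\overline{\Delta}_t$, such that, for each $\tau\in\{0,\dots,t-2\}$, if $g\in\mathcal{G}_{t-\tau}$ and $\mathbb{P}(g)>0$, then $\underline{\Delta}_t\le\Delta_t^\tau(g)\le\overline{\Delta}_t$. Then a lower bound for $\Delta_t^{t-1}(C_1)$ is $$L_t=\frac{RF_t}{FS_1}+\mathbb{P}(D_{i,t}>D_{i,1}\mid Z_i=0)\frac{\underline{\Delta}_t}{FS_1}-\mathbb{P}(D_{i,t}>D_{i,1}\mid Z_i=1)\frac{\overline{\Delta}_t}{FS_1}$$ and an upper bound is $$U_t=\frac{RF_t}{FS_1}+\mathbb{P}(D_{i,t}>D_{i,1}\mid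 Z_i=0)\frac{\overline{\Delta}_t}{FS_1}-\mathbb{P}(D_{i,t}>D_{i,1}\mid Z_i=1)\frac{\underline{\Delta}_t}{FS_1};$$ that is, $L_t\le\Delta_t^{t-1}(C_1)\le U_t$. If, in addition, for each $\tau\in\{0,\dots,t-2\}$ and all $g,g'\in\mathcal{G}_{t-\tau}$ with $\mathbb{P}(g)>0$ and $\mathbb{P}(g')>0$, $\Delta_t^\tau(g)=\Delta_t^\tau(g')$, then $$L_t^*=\frac{RF_t}{FS_1}+\underline{\Delta}_t\frac{(FS_1-FS_t)}{FS_1}+(\overline{\Delta}_t-\underline{\Delta}_t)\sum_{k=2}^t\mathbf{1}(FS_{k-1}<FS_k)\frac{FS_{k-1}-FS_k}{FS_1}$$ is a lower bound for $\Delta_t^{t-1}(C_1)$ and $$U_t^*=\frac{RF_t}{FS_1}+\overline{\Delta}_t\frac{(FS_1-FS_t)}{FS_1}+(\underline{\Delta}_t-\overline{\Delta}_t)\sum_{k=2}^t\mathbf{1}(FS_{k-1}<FS_k)\frac{FS_{k-1}-FS_k}{FS_1}$$ is an upper bound, i.e. $L_t^*\le\Delta_t^{t-1}(C_1)\le U_t^*$, and these bounds are (weakly) tighter than the previous ones: $L_t\le L_t^*$ and $U_t^*\le U_t$.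
   Context: Setting. Time is $t\in\mathcal{T}=\{1,\dots,T\}$; $i$ denotes a generic observation. $Z_i\in\{0,1\}$ is a time-invariant binary instrument with $0<\mathbb{P}(Z_i=1)<1$. $D_{i,t}(z)\in\{0,1\}$ is the potential treatment status at $t$ under instrument value $z$, and the observed status is $D_{i,t}=D_{i,t}(Z_i)$. No unit is treated before period 1. $Y_{i,t}(0,z)$ is the potential outcome at $t$ if $i$ has not been treated up to $t$ and the instrument is $z$; $Y_{i,t}(1,\tau,z)$, $\tau\in\{0,\dots,t-1\}$, is the potential outcome at $t$ if $i$ is first treated at period $t-\tau$ and the instrument is $z$. The observed outcome $Y_{i,t}$ equals $Y_{i,t}(0,Z_i)$ if $i$ has not been treated up to $t$, and $Y_{i,t}(1,t-s,Z_i)$ if $i$ was first treated at $s\le t$. All expectations written are assumed to exist (one may take all potential outcomes to be integrable). Latent types at $t$ (events): $AT_t=\{D_{i,t}(1)=D_{i,t}(0)=1\}$, $C_t=\{D_{i,t}(1)>D_{i,t}(0)\}$, $F_t=\{D_{i,t}(1)<D_{i,t}(0)\}$, $NT_t=\{D_{i,t}(1)=D_{i,t}(0)=0\}$. $C_{t:t'}$ means complier in every period from $t$ to $t'$ ($\bigcap_{s=t}^{t'}C_s$), similarly $F_{t:t'}$, $NT_{t:t'}$; a tuple denotes the intersection of its entries. Sets of latent groups: $\mathcal{G}^+_2=\{(NT_1,C_2)\}$, $\mathcal{G}^-_2=\{(C_1,AT_2),(NT_1,F_2)\}$, and for $t\in\mathcal{T}\setminus\{1,2\}$, $$\mathcal{G}^+_t=\{(NT_{1:t-1},C_t),\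 (NT_{1:\ell-1},F_{\ell:t-1},AT_t):\ell=2,\dots,t-1\},$$ $$\mathcal{G}^-_t=\{(C_{1:t-1},AT_t),\ (NT_{1:t-1},F_t),\ (NT_{1:\ell-1},C_{\ell:t-1},AT_t):\ell=2,\dots,t-1\}.$$ For $t\in\mathcal{T}\setminus\{1\}$, $\mathcal{G}_t=\mathcal{G}^+_t\cup\mathcal{G}^-_t$. Estimands: $RF_t=\mathbb{E}[Y_{i,t}\mid Z_i=1]-\mathbb{E}[Y_{i,t}\mid Z_i=0]$ and $FS_t=\mathbb{E}[D_{i,t}\mid Z_i=1]-\mathbb{E}[D_{i,t}\mid Z_i=0]$. Causal effects (under exclusion): for a latent group $g$, $\Delta_t^\tau(g)=\mathbb{E}[Y_{i,t}(1,\tau)-Y_{i,t}(0)\mid g]$. $\mathbf{1}(\cdot)$ is the indicator function. *)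

theory Defs
  imports "HOL-Probability.Probability"
begin

text \<open>
  A generic observation is a point of a probability space \<open>M\<close>; binary variables are \<open>bool\<close>-valued,
  with \<open>False < True\<close> playing the role of \<open>0 < 1\<close>. Periods are the naturals \<open>1, \<dots>, T\<close>.
  Throughout, \<open>D t z\<close> is the potential treatment status at \<open>t\<close>; \<open>Y0z t z\<close> and \<open>Y1z t \<tau> z\<close> are the
  potential outcomes indexed by the instrument, \<open>Y0 t\<close> and \<open>Y1 t \<tau>\<close> those that are not.
\<close>

definition obs_treat :: "('a \<Rightarrow> bool) \<Rightarrow> (nat \<Rightarrow> bool \<Rightarrow> 'a \<Rightarrow> bool) \<Rightarrow> nat \<Rightarrow> 'a \<Rightarrow> bool" where
  "obs_treat Z D t \<omega> = D t (Z \<omega>) \<omega>"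

definition first_treat :: "('a \<Rightarrow> bool) \<Rightarrow> (nat \<Rightarrow> bool \<Rightarrow> 'a \<Rightarrow> bool) \<Rightarrow> 'a \<Rightarrow> nat" where
  "first_treat Z D \<omega> = (LEAST s. 1 \<le> s \<and> obs_treat Z D s \<omega>)"

definition obs_outcome :: "('a \<Rightarrow> bool) \<Rightarrow> (nat \<Rightarrow> bool \<Rightarrow> 'a \<Rightarrow> bool) \<Rightarrow>
    (nat \<Rightarrow> bool \<Rightarrow> 'a \<Rightarrow> real) \<Rightarrow> (nat \<Rightarrow> nat \<Rightarrow> bool \<Rightarrow> 'a \<Rightarrow> real) \<Rightarrow> nat \<Rightarrow> 'a \<Rightarrow> real" where
  "obs_outcome Z D Y0z Y1z t \<omega> =
     (if \<exists>s\<in>{1..t}. obs_treat Z D s \<omega>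
      then Y1z t (t - first_treat Z D \<omega>) (Z \<omega>) \<omega>
      else Y0z t (Z \<omega>) \<omega>)"

text \<open>Expectation conditional on an event of positive probability.\<close>

definition cond_expect :: "'a measure \<Rightarrow> ('a \<Rightarrow> real) \<Rightarrow> 'a set \<Rightarrow> real" where
  "cond_expect M X A = (\<integral>\<omega>. X \<omega> \<partial>uniform_measure M A)"

text \<open>
  Independence of two random elements with possibly different target types
  (\<open>prob_space.indep_var\<close> requires equal ones): independence of the generated \<open>\<sigma>\<close>-algebras,
  including measurability of both elements.
\<close>

definition indep_elements ::
    "'a measure \<Rightarrow> 'b measure \<Rightarrow> ('a \<Rightarrow> 'b) \<Rightarrow> 'c measure \<Rightarrow> ('a \<Rightarrow> 'c) \<Rightarrow> bool" where
  "indep_elements M N X K W \<longleftrightarrow>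
     X \<in> M \<rightarrow>\<^sub>M N \<and> W \<in> M \<rightarrow>\<^sub>M K \<and>
     prob_space.indep_set M (sets (vimage_algebra (space M) X N)) (sets (vimage_algebra (space M) W K))"

text \<open>The random vector
  \<open>(Y\<^sub>t(0), Y\<^sub>t(1,0), \<dots>, Y\<^sub>t(1,t-1), D\<^sub>1(1), D\<^sub>1(0), \<dots>, D\<^sub>t(1), D\<^sub>t(0))\<close> and its target space.\<close>

definition potential_vector :: "(nat \<Rightarrow> bool \<Rightarrow> 'a \<Rightarrow> bool) \<Rightarrow> (nat \<Rightarrow> 'a \<Rightarrow> real) \<Rightarrow>
    (nat \<Rightarrow> nat \<Rightarrow> 'a \<Rightarrow> real) \<Rightarrow> nat \<Rightarrow> 'a \<Rightarrow> real \<times> (nat \<Rightarrow> real) \<times> (nat \<times> bool \<Rightarrow> bool)" where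
  "potential_vector D Y0 Y1 t \<omega> =
     (Y0 t \<omega>, (\<lambda>\<tau>\<in>{..<t}. Y1 t \<tau> \<omega>), (\<lambda>(s, z)\<in>{1..t} \<times> UNIV. D s z \<omega>))"

definition potential_space :: "nat \<Rightarrow> (real \<times> (nat \<Rightarrow> real) \<times> (nat \<times> bool \<Rightarrow> bool)) measure" where
  "potential_space t =
     borel \<Otimes>\<^sub>M (PiM {..<t} (\<lambda>_. borel)) \<Otimes>\<^sub>M (PiM ({1..t} \<times> UNIV) (\<lambda>_. count_space UNIV))"

definition AT :: "'a measure \<Rightarrow> (nat \<Rightarrow> bool \<Rightarrow> 'a \<Rightarrow> bool) \<Rightarrow> nat \<Rightarrow> 'a set" where
  "AT M D t = {\<omega> \<in> space M. D t True \<omega> \<and> D t False \<omega>}"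

definition CO :: "'a measure \<Rightarrow> (nat \<Rightarrow> bool \<Rightarrow> 'a \<Rightarrow> bool) \<Rightarrow> nat \<Rightarrow> 'a set" where
  "CO M D t = {\<omega> \<in> space M. D t True \<omega> > D t False \<omega>}"

definition DF :: "'a measure \<Rightarrow> (nat \<Rightarrow> bool \<Rightarrow> 'a \<Rightarrow> bool) \<Rightarrow> nat \<Rightarrow> 'a set" where
  "DF M D t = {\<omega> \<in> space M. D t True \<omega> < D t False \<omega>}"

definition NT :: "'a measure \<Rightarrow> (nat \<Rightarrow> bool \<Rightarrow> 'a \<Rightarrow> bool) \<Rightarrow> nat \<Rightarrow> 'a set" where
  "NT M D t = {\<omega> \<in> space M. \<not> D t True \<omega> \<and> \<not> D t False \<omega>}"

text \<open>
  The sets \<open>\<G>\<^sup>+\<^sub>t\<close> and \<open>\<G>\<^sup>-\<^sub>t\<close> for \<open>t \<ge> 2\<close>, a latent group being the corresponding event.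
  For \<open>t = 2\<close> the families over \<open>\<ell> \<in> {2..t - 1}\<close> are empty, so no separate case is needed.
\<close>

definition groups_plus :: "'a measure \<Rightarrow> (nat \<Rightarrow> bool \<Rightarrow> 'a \<Rightarrow> bool) \<Rightarrow> nat \<Rightarrow> 'a set set" where
  "groups_plus M D t =
     {(\<Inter>s\<in>{1..t - 1}. NT M D s) \<inter> CO M D t} \<union>
     (\<lambda>l. (\<Inter>s\<in>{1..l - 1}. NT M D s) \<inter> (\<Inter>s\<in>{l..t - 1}. DF M D s) \<inter> AT M D t) ` {2..t - 1}"

definition groups_minus :: "'a measure \<Rightarrow> (nat \<Rightarrow> bool \<Rightarrow> 'a \<Rightarrow> bool) \<Rightarrow> nat \<Rightarrow> 'a set set" where
  "groups_minus M D t =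
     {(\<Inter>s\<in>{1..t - 1}. CO M D s) \<inter> AT M D t,
      (\<Inter>s\<in>{1..t - 1}. NT M D s) \<inter> DF M D t} \<union>
     (\<lambda>l. (\<Inter>s\<in>{1..l - 1}. NT M D s) \<inter> (\<Inter>s\<in>{l..t - 1}. CO M D s) \<inter> AT M D t) ` {2..t - 1}"

definition groups :: "'a measure \<Rightarrow> (nat \<Rightarrow> bool \<Rightarrow> 'a \<Rightarrow> bool) \<Rightarrow> nat \<Rightarrow> 'a set set" where
  "groups M D t = groups_plus M D t \<union> groups_minus M D t"

definition instr_diff :: "'a measure \<Rightarrow> ('a \<Rightarrow> bool) \<Rightarrow> ('a \<Rightarrow> real) \<Rightarrow> real" where
  "instr_diff M Z X =
     cond_expect M X {\<omega> \<in> space M. Z \<omega>} - cond_expect M X {\<omega> \<in> space M. \<not> Z \<omega>}"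

definition reduced_form :: "'a measure \<Rightarrow> ('a \<Rightarrow> bool) \<Rightarrow> (nat \<Rightarrow> bool \<Rightarrow> 'a \<Rightarrow> bool) \<Rightarrow>
    (nat \<Rightarrow> bool \<Rightarrow> 'a \<Rightarrow> real) \<Rightarrow> (nat \<Rightarrow> nat \<Rightarrow> bool \<Rightarrow> 'a \<Rightarrow> real) \<Rightarrow> nat \<Rightarrow> real" where
  "reduced_form M Z D Y0z Y1z t = instr_diff M Z (obs_outcome Z D Y0z Y1z t)"

definition first_stage ::
    "'a measure \<Rightarrow> ('a \<Rightarrow> bool) \<Rightarrow> (nat \<Rightarrow> bool \<Rightarrow> 'a \<Rightarrow> bool) \<Rightarrow> nat \<Rightarrow> real" where
  "first_stage M Z D t = instr_diff M Z (\<lambda>\<omega>. of_bool (obs_treat Z D t \<omega>))"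

definition effect :: "'a measure \<Rightarrow> (nat \<Rightarrow> 'a \<Rightarrow> real) \<Rightarrow> (nat \<Rightarrow> nat \<Rightarrow> 'a \<Rightarrow> real) \<Rightarrow>
    nat \<Rightarrow> nat \<Rightarrow> 'a set \<Rightarrow> real" where
  "effect M Y0 Y1 t \<tau> g = cond_expect M (\<lambda>\<omega>. Y1 t \<tau> \<omega> - Y0 t \<omega>) g"

end

theory Submission
  imports Defs
begin

text \<open>
  Independence and exclusion turn \<open>RF\<^sub>t\<close> into the sum over \<open>s \<le> t\<close> of
  \<open>\<E>[(1(E\<^sub>s(1)) - 1(E\<^sub>s(0))) (Y\<^sub>t(1,t-s) - Y\<^sub>t(0))]\<close>, where \<open>E\<^sub>s(z)\<close> is the event of being first treated
  at \<open>s\<close> under \<open>z\<close>. By monotonicity the term \<open>s = 1\<close> is \<open>FS\<^sub>1 \<Delta>\<^sub>t\<^sup>t\<^sup>-\<^sup>1(C\<^sub>1)\<close>. For \<open>s \<ge> 2\<close>, irreversibility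
  (which independence transfers from the observed to the potential treatments) makes
  \<open>E\<^sub>s(1) - E\<^sub>s(0)\<close> the disjoint union of \<open>\<G>\<^sup>+\<^sub>s\<close> and \<open>E\<^sub>s(0) - E\<^sub>s(1)\<close> that of \<open>\<G>\<^sup>-\<^sub>s\<close>, up to null sets.
  So the term is at most \<open>\<Delta>hi P(E\<^sub>s(1)) - \<Delta>lo P(E\<^sub>s(0))\<close>, dually from below, and
  \<open>P(D\<^sub>t > D\<^sub>1 | Z = z)\<close> is the sum of the \<open>P(E\<^sub>s(z))\<close> over \<open>s \<ge> 2\<close>. With homogeneous effects \<open>\<delta>\<^sub>s\<close> the term
  equals \<open>\<delta>\<^sub>s (FS\<^sub>s - FS\<^sub>s\<^sub>-\<^sub>1)\<close>, and all claims become termwise inequalities.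
\<close>

section \<open>First treatment dates and the observed outcome\<close>

definition onset :: "(nat \<Rightarrow> bool \<Rightarrow> 'a \<Rightarrow> bool) \<Rightarrow> nat \<Rightarrow> bool \<Rightarrow> 'a \<Rightarrow> bool" where
  "onset D s z \<omega> \<longleftrightarrow> D s z \<omega> \<and> (\<forall>r\<in>{1..<s}. \<not> D r z \<omega>)"

lemma onset_1 [simp]: "onset D (Suc 0) z \<omega> = D (Suc 0) z \<omega>"
  by (simp add: onset_def)

lemma pred_onset:
  assumes "1 \<le> s" and "\<And>r. r \<in> {1..s} \<Longrightarrow> Measurable.pred N (D r z)"
  shows "Measurable.pred N (onset D s z)"
proof -
  have "Measurable.pred N (\<lambda>\<omega>. D s z \<omega> \<and> (\<forall>r\<in>{1..<s}. \<not> D r z \<omega>))"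
    using assms by (intro pred_intros_logic pred_intros_finite) auto
  then show ?thesis
    by (simp add: onset_def [abs_def])
qed

text \<open>Since \<open>onset\<close> rules out treatment in all earlier periods, and not only in
  the preceding one, at most one summand is nonzero at every sample point, and it sits at
  \<open>first_treat\<close>. The identity is therefore pointwise rather than almost sure.\<close>

lemma obs_outcome_eq_sum:
  "obs_outcome Z D Y0z Y1z t \<omega> = Y0z t (Z \<omega>) \<omega> +
     (\<Sum>s=1..t. of_bool (onset D s (Z \<omega>) \<omega>) * (Y1z t (t - s) (Z \<omega>) \<omega> - Y0z t (Z \<omega>) \<omega>))"
proof (cases "\<exists>s\<in>{1..t}. obs_treat Z D s \<omega>")
  case False
  then show ?thesis
    by (auto simp: obs_outcome_def obs_treat_def onset_def intro!: sum.neutral)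
next
  case True
  define f where "f = first_treat Z D \<omega>"
  obtain s where s: "s \<in> {1..t}" "D s (Z \<omega>) \<omega>"
    using True by (auto simp: obs_treat_def)
  have f: "1 \<le> f \<and> D f (Z \<omega>) \<omega>"
    unfolding f_def first_treat_def obs_treat_def by (rule LeastI[of _ s]) (use s in auto)
  have least: "f \<le> r" if "1 \<le> r" "D r (Z \<omega>) \<omega>" for r
    unfolding f_def first_treat_def obs_treat_def by (rule Least_le) (use that in auto)
  have "f \<in> {1..t}"
    using f least[of s] s by auto
  moreover have "onset D r (Z \<omega>) \<omega> \<longleftrightarrow> r = f" if "r \<in> {1..t}" for r
    using f least that unfolding onset_def by (fastforce simp: not_le[symmetric])
  then have "(\<Sum>s=1..t. of_bool (onset D s (Z \<omega>) \<omega>) * (Y1z t (t - s) (Z \<omega>) \<omega> - Y0z t (Z \<omega>) \<omega>)) =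
      (\<Sum>s=1..t. if s = f then Y1z t (t - s) (Z \<omega>) \<omega> - Y0z t (Z \<omega>) \<omega> else 0)"
    by (intro sum.cong) auto
  ultimately show ?thesis
    using True by (simp add: obs_outcome_def f_def[symmetric])
qed

section \<open>Conditional expectations given events and finite disjoint unions\<close>

lemma (in prob_space) cond_expect_eq:
  assumes [measurable]: "A \<in> events" "X \<in> borel_measurable M" and pos: "0 < prob A"
  shows "cond_expect M X A = (\<integral>\<omega>. X \<omega> * indicator A \<omega> \<partial>M) / prob A"
proof -
  have "uniform_measure M A = density M (\<lambda>\<omega>. ennreal (indicator A \<omega> / prob A))"
    unfolding uniform_measure_def using pos
    by (intro density_cong) (auto simp: emeasure_eq_measure divide_ennreal[symmetric] split: split_indicator)
  then have "cond_expect M X A = (\<integral>\<omega>. (indicator A \<omega> / prob A) *\<^sub>R X \<omega> \<partial>M)"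
    unfolding cond_expect_def by (simp add: integral_density)
  also have "\<dots> = (\<integral>\<omega>. X \<omega> * indicator A \<omega> / prob A \<partial>M)"
    by (intro Bochner_Integration.integral_cong) auto
  finally show ?thesis
    by simp
qed

text \<open>Multiplying by \<open>prob A\<close> makes null events harmless: there both sides
  vanish, whatever value \<open>cond_expect\<close> takes.\<close>

lemma (in prob_space) integral_indicator_eq_cond_expect:
  assumes [measurable]: "A \<in> events" "X \<in> borel_measurable M"
  shows "(\<integral>\<omega>. X \<omega> * indicator A \<omega> \<partial>M) = cond_expect M X A * prob A"
proof (cases "prob A = 0")
  case True
  then have "AE \<omega> in M. \<omega> \<notin> A"
    by (simp add: prob_eq_0)
  then have "(\<integral>\<omega>. X \<omega> * indicator A \<omega> \<partial>M) = (\<integral>\<omega>. 0 \<partial>M)"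
    by (intro integral_cong_AE) (auto elim!: eventually_mono)
  then show ?thesis
    using True by simp
next
  case False
  then show ?thesis
    by (simp add: cond_expect_eq zero_less_measure_iff)
qed

text \<open>Total expectation over the members of \<open>G\<close>. A null member contributes zero
  to the integral and to the probability, so bounds on the members of positive probability
  suffice.\<close>

lemma (in prob_space) integral_Union_bounds:
  assumes G: "finite G" "disjoint G" "G \<subseteq> events" and W: "integrable M W"
    and bounds: "\<And>g. g \<in> G \<Longrightarrow> 0 < prob g \<Longrightarrow> lo \<le> cond_expect M W g \<and> cond_expect M W g \<le> hi"
  shows "lo * prob (\<Union>G) \<le> (\<integral>\<omega>. W \<omega> * indicator (\<Union>G) \<omega> \<partial>M)"
    and "(\<integral>\<omega>. W \<omega> * indicator (\<Union>G) \<omega> \<partial>M) \<le> hi * prob (\<Union>G)"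
proof -
  have dj: "disjoint_family_on (\<lambda>g. g) G"
    using G(2) by (auto simp: disjoint_family_on_def disjoint_def)
  have "prob (\<Union>G) = (\<Sum>g\<in>G. prob g)"
    using finite_measure_finite_Union[of G "\<lambda>g. g"] G dj by auto
  moreover have "(\<integral>\<omega>. W \<omega> * indicator (\<Union>G) \<omega> \<partial>M) = (\<integral>\<omega>. (\<Sum>g\<in>G. W \<omega> * indicator g \<omega>) \<partial>M)"
  proof (intro Bochner_Integration.integral_cong refl)
    fix \<omega>
    have "indicator (\<Union>G) \<omega> = (\<Sum>g\<in>G. indicator g \<omega> :: real)"
      using indicator_UN_disjoint[OF G(1) dj, of \<omega>] by simp
    then show "W \<omega> * indicator (\<Union>G) \<omega> = (\<Sum>g\<in>G. W \<omega> * indicator g \<omega>)"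
      by (simp add: sum_distrib_left)
  qed
  moreover have "\<dots> = (\<Sum>g\<in>G. \<integral>\<omega>. W \<omega> * indicator g \<omega> \<partial>M)"
    using G W by (intro Bochner_Integration.integral_sum integrable_real_mult_indicator) auto
  moreover have "\<dots> = (\<Sum>g\<in>G. cond_expect M W g * prob g)"
    using G W by (intro sum.cong refl integral_indicator_eq_cond_expect) auto
  moreover have "lo * prob g \<le> cond_expect M W g * prob g \<and> cond_expect M W g * prob g \<le> hi * prob g"
    if "g \<in> G" for g
    using bounds[OF that] by (cases "prob g = 0") (auto intro!: mult_right_mono simp: zero_less_measure_iff)
  ultimately show "lo * prob (\<Union>G) \<le> (\<integral>\<omega>. W \<omega> * indicator (\<Union>G) \<omega> \<partial>M)"
    and "(\<integral>\<omega>. W \<omega> * indicator (\<Union>G) \<omega> \<partial>M) \<le> hi * prob (\<Union>G)"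
    by (simp_all add: sum_distrib_left sum_mono)
qed

section \<open>Latent groups, treated symmetrically in the two arms\<close>

definition only_arm :: "'a measure \<Rightarrow> (nat \<Rightarrow> bool \<Rightarrow> 'a \<Rightarrow> bool) \<Rightarrow> bool \<Rightarrow> nat \<Rightarrow> 'a set" where
  "only_arm M D z s = {\<omega> \<in> space M. D s z \<omega> \<and> \<not> D s (\<not> z) \<omega>}"

text \<open>
  The latent groups that are first treated at \<open>s\<close> under \<open>z\<close> but not under \<open>\<not> z\<close>; the index \<open>l\<close> is the
  period of first treatment under \<open>\<not> z\<close>.
\<close>

definition arm_groups ::
    "'a measure \<Rightarrow> (nat \<Rightarrow> bool \<Rightarrow> 'a \<Rightarrow> bool) \<Rightarrow> bool \<Rightarrow> nat \<Rightarrow> nat set \<Rightarrow> 'a set set" where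
  "arm_groups M D z s L =
     insert ((\<Inter>r\<in>{1..s - 1}. NT M D r) \<inter> only_arm M D z s)
       ((\<lambda>l. (\<Inter>r\<in>{1..l - 1}. NT M D r) \<inter> (\<Inter>r\<in>{l..s - 1}. only_arm M D (\<not> z) r) \<inter> AT M D s) ` L)"

lemma only_arm_True: "only_arm M D True = CO M D"
  and only_arm_False: "only_arm M D False = DF M D"
  by (auto simp: fun_eq_iff only_arm_def CO_def DF_def)

lemma groups_plus_eq: "groups_plus M D s = arm_groups M D True s {2..s - 1}"
  by (simp add: groups_plus_def arm_groups_def only_arm_True only_arm_False)

text \<open>The two families differ exactly in the index \<open>l = 1\<close>. Here it yields the
  group of compliers up to \<open>s - 1\<close> who are always takers at \<open>s\<close>; its
  mirror image, made of defiers from period 1 on, is absent from \<open>groups_plus\<close>.\<close>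

lemma groups_minus_eq:
  assumes "2 \<le> s"
  shows "groups_minus M D s = arm_groups M D False s {1..s - 1}"
proof -
  have "{1..s - 1} = insert 1 {2..s - 1}"
    using assms by auto
  then show ?thesis
    by (simp add: groups_minus_def arm_groups_def only_arm_True only_arm_False insert_commute)
qed

lemma finite_arm_groups: "finite L \<Longrightarrow> finite (arm_groups M D z s L)"
  by (simp add: arm_groups_def)

lemma arm_groups_events:
  assumes "L \<subseteq> {1..s - 1}" "2 \<le> s" and D: "\<And>r z. r \<in> {1..s} \<Longrightarrow> Measurable.pred M (D r z)"
  shows "arm_groups M D z s L \<subseteq> sets M"
proof -
  have [measurable]: "NT M D r \<in> sets M" "only_arm M D z' r \<in> sets M" "AT M D r \<in> sets M"
    if "r \<in> {1..s}" for r z'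
    using D[OF that] by (auto simp: NT_def only_arm_def AT_def pred_def[symmetric])
  have "(\<Inter>r\<in>{1..s - 1}. NT M D r) \<in> sets M"
    using assms(2) by (intro sets.finite_INT) auto
  moreover have "(\<Inter>r\<in>{1..l - 1}. NT M D r) \<inter> (\<Inter>r\<in>{l..s - 1}. only_arm M D (\<not> z) r) \<inter> AT M D s \<in> sets M"
    if "l \<in> L" for l
  proof -
    have l: "1 \<le> l" "l \<le> s - 1"
      using that assms(1) by auto
    then have "(\<Inter>r\<in>{l..s - 1}. only_arm M D (\<not> z) r) \<inter> AT M D s \<in> sets M"
      using assms(2) by (intro sets.Int sets.finite_INT) auto
    \<comment> \<open>For \<open>l = 1\<close> the intersection over the empty index set is
      \<open>UNIV\<close>, which need not be an event; in that case it simply drops out of the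
      product with the other factors.\<close>
    moreover have "(\<Inter>r\<in>{1..l - 1}. NT M D r) \<in> sets M" if "l \<noteq> 1"
      using assms(2) l that by (intro sets.finite_INT) auto
    ultimately show ?thesis
      by (cases "l = 1") (simp_all add: Int_assoc)
  qed
  ultimately show ?thesis
    using assms(2) by (auto simp: arm_groups_def)
qed

text \<open>The inserted group is untreated under \<open>\<not> z\<close> at \<open>s\<close>,
  whereas all others lie in \<open>AT M D s\<close>. Groups with indices \<open>l < m\<close> differ
  at period \<open>l\<close>, where the first is treated under \<open>\<not> z\<close> and the
  second is not.\<close>

lemma disjoint_arm_groups:
  assumes "L \<subseteq> {1..s - 1}"
  shows "disjoint (arm_groups M D z s L)"
proof -
  define B where "B = (\<Inter>r\<in>{1..s - 1}. NT M D r) \<inter> only_arm M D z s"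
  define C where "C l = (\<Inter>r\<in>{1..l - 1}. NT M D r) \<inter> (\<Inter>r\<in>{l..s - 1}. only_arm M D (\<not> z) r) \<inter> AT M D s" for l
  have 1: "B \<inter> C l = {}" for l
    by (cases z) (auto simp: B_def C_def only_arm_def AT_def)
  have 2: "C l \<inter> C m = {}" if "l \<in> L" "m \<in> L" "l < m" for l m
  proof -
    have "C l \<subseteq> only_arm M D (\<not> z) l" "C m \<subseteq> NT M D l"
      using that assms unfolding C_def by fastforce+
    then show ?thesis
      by (cases z) (auto simp: only_arm_def NT_def)
  qed
  have 3: "C l = C m \<or> C l \<inter> C m = {}" if "l \<in> L" "m \<in> L" for l m
    using 2[OF that] 2[OF that(2,1)] by (cases l m rule: linorder_cases) auto
  have "arm_groups M D z s L = insert B (C ` L)"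
    by (simp add: arm_groups_def B_def C_def)
  then show ?thesis
  proof (simp only:, intro disjointI)
    fix a b
    assume "a \<in> insert B (C ` L)" "b \<in> insert B (C ` L)" "a \<noteq> b"
    then show "a \<inter> b = {}"
      using 1 3 by (elim insertE imageE) (simp_all add: Int_commute[of _ B], metis)
  qed
qed

text \<open>Every group keeps arm \<open>z\<close> untreated before \<open>s\<close> and treats it
  at \<open>s\<close>, while arm \<open>\<not> z\<close> is either untreated at \<open>s\<close> or
  already treated at some \<open>l < s\<close>. This inclusion is pointwise.\<close>

lemma Union_arm_groups_subset:
  assumes "L \<subseteq> {1..s - 1}" "\<omega> \<in> \<Union>(arm_groups M D z s L)"
  shows "onset D s z \<omega> \<and> \<not> onset D s (\<not> z) \<omega>"
proof -
  consider "\<omega> \<in> (\<Inter>r\<in>{1..s - 1}. NT M D r) \<inter> only_arm M D z s"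
    | l where "l \<in> L" "\<omega> \<in> (\<Inter>r\<in>{1..l - 1}. NT M D r) \<inter> (\<Inter>r\<in>{l..s - 1}. only_arm M D (\<not> z) r) \<inter> AT M D s"
    using assms(2) by (auto simp: arm_groups_def)
  then show ?thesis
  proof cases
    case 1
    then have "\<not> D r z \<omega>" if "r \<in> {1..<s}" for r
      using that by (cases z) (auto simp: NT_def)
    with 1 show ?thesis
      by (auto simp: onset_def only_arm_def)
  next
    case 2
    have "\<not> D r z \<omega>" if "r \<in> {1..<s}" for r
    proof (cases "r < l")
      case True
      then have "\<omega> \<in> NT M D r" using 2 that by auto
      then show ?thesis by (cases z) (auto simp: NT_def)
    next
      case False
      then have "\<omega> \<in> only_arm M D (\<not> z) r" using 2 that by auto
      then show ?thesis by (auto simp: only_arm_def)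
    qed
    moreover have l: "l \<in> {1..<s}" using subsetD[OF assms(1) 2(1)] by auto
    then have "D l (\<not> z) \<omega>" using 2 by (auto simp: only_arm_def)
    moreover have "D s z \<omega>" using 2 by (cases z) (auto simp: AT_def)
    ultimately show ?thesis
      using l by (auto simp: onset_def)
  qed
qed

text \<open>If arm \<open>\<not> z\<close> is untreated at \<open>s\<close>, irreversibility makes
  it untreated before, which gives the inserted group. Otherwise its first treatment date
  \<open>l\<close> precedes \<open>s\<close>, and irreversibility keeps it treated from
  \<open>l\<close> on, which gives the group with index \<open>l\<close>. The index 1 is demanded
  only for points treated at period 1 under \<open>\<not> z\<close> alone, so that monotonicity can
  later dispense with it.\<close>

lemma onset_in_Union_arm_groups:
  assumes \<omega>: "\<omega> \<in> space M" and "1 \<le> s"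
    and mono: "\<And>z r r'. 1 \<le> r \<Longrightarrow> r \<le> r' \<Longrightarrow> r' \<le> s \<Longrightarrow> D r z \<omega> \<Longrightarrow> D r' z \<omega>"
    and L: "{2..s - 1} \<subseteq> L" "D 1 (\<not> z) \<omega> \<Longrightarrow> \<not> D 1 z \<omega> \<Longrightarrow> 1 \<in> L"
    and on: "onset D s z \<omega>" "\<not> onset D s (\<not> z) \<omega>"
  shows "\<omega> \<in> \<Union>(arm_groups M D z s L)"
proof (cases "D s (\<not> z) \<omega>")
  case False
  have "\<omega> \<in> NT M D r" if "r \<in> {1..s - 1}" for r
  proof -
    have "\<not> D r z \<omega>" using on(1) that by (auto simp: onset_def)
    moreover have "r \<le> s" using that by (simp, arith)
    then have "\<not> D r (\<not> z) \<omega>" using mono[of r s "\<not> z"] False that by auto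
    ultimately show ?thesis using \<omega> by (cases z) (auto simp: NT_def)
  qed
  moreover have "\<omega> \<in> only_arm M D z s"
    using False on \<omega> by (auto simp: only_arm_def onset_def)
  ultimately show ?thesis
    by (auto simp: arm_groups_def)
next
  case True
  define l where "l = (LEAST r. 1 \<le> r \<and> D r (\<not> z) \<omega>)"
  obtain r where r: "r \<in> {1..<s}" "D r (\<not> z) \<omega>"
    using on(2) True by (auto simp: onset_def)
  have l: "1 \<le> l \<and> D l (\<not> z) \<omega>"
    unfolding l_def by (rule LeastI[of _ r]) (use r in auto)
  have least: "l \<le> r'" if "1 \<le> r'" "D r' (\<not> z) \<omega>" for r'
    unfolding l_def by (rule Least_le) (use that in auto)
  have "l < s"
    using least[of r] r by auto
  have nz: "\<not> D r' z \<omega>" if "r' \<in> {1..<s}" for r'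
    using on(1) that by (auto simp: onset_def)
  have "l \<in> L"
    using L l nz[of 1] \<open>l < s\<close> by (cases "l = 1") auto
  moreover have "\<omega> \<in> NT M D r'" if "r' \<in> {1..l - 1}" for r'
  proof -
    have "1 \<le> r'" "r' < l" "r' < s" using that l \<open>l < s\<close> by auto
    then show ?thesis
      using nz[of r'] least[of r'] \<omega> by (cases z) (auto simp: NT_def)
  qed
  moreover have "\<omega> \<in> only_arm M D (\<not> z) r'" if "r' \<in> {l..s - 1}" for r'
  proof -
    have "1 \<le> r'" "l \<le> r'" "r' < s" using that l \<open>l < s\<close> by auto
    then show ?thesis
      using nz[of r'] mono[of l r' "\<not> z"] l \<omega> by (auto simp: only_arm_def)
  qed
  moreover have "\<omega> \<in> AT M D s"
    using True on(1) \<omega> by (cases z) (auto simp: AT_def onset_def)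
  ultimately have "\<omega> \<in> (\<Inter>r\<in>{1..l - 1}. NT M D r) \<inter> (\<Inter>r\<in>{l..s - 1}. only_arm M D (\<not> z) r) \<inter> AT M D s"
    by blast
  then show ?thesis
    using \<open>l \<in> L\<close> unfolding arm_groups_def by blast
qed

section \<open>The setting and the independence of the instrument\<close>

locale staggered_iv = prob_space M for M :: "'a measure" +
  fixes T :: nat and Z :: "'a \<Rightarrow> bool" and D :: "nat \<Rightarrow> bool \<Rightarrow> 'a \<Rightarrow> bool"
    and Y0z :: "nat \<Rightarrow> bool \<Rightarrow> 'a \<Rightarrow> real" and Y1z :: "nat \<Rightarrow> nat \<Rightarrow> bool \<Rightarrow> 'a \<Rightarrow> real"
    and Y0 :: "nat \<Rightarrow> 'a \<Rightarrow> real" and Y1 :: "nat \<Rightarrow> nat \<Rightarrow> 'a \<Rightarrow> real"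
  assumes Z_meas [measurable]: "Measurable.pred M Z"
    and Z_pos: "0 < \<P>(\<omega> in M. Z \<omega>)" and Z_less: "\<P>(\<omega> in M. Z \<omega>) < 1"
    and D_meas: "\<And>s z. s \<in> {1..T} \<Longrightarrow> Measurable.pred M (D s z)"
    and Y0z_int: "\<And>s z. s \<in> {1..T} \<Longrightarrow> integrable M (Y0z s z)"
    and Y1z_int: "\<And>s \<tau> z. s \<in> {1..T} \<Longrightarrow> \<tau> \<in> {0..s - 1} \<Longrightarrow> integrable M (Y1z s \<tau> z)"
    and Y0_int: "\<And>s. s \<in> {1..T} \<Longrightarrow> integrable M (Y0 s)"
    and Y1_int: "\<And>s \<tau>. s \<in> {1..T} \<Longrightarrow> \<tau> \<in> {0..s - 1} \<Longrightarrow> integrable M (Y1 s \<tau>)"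
    and irreversible: "\<And>s. s \<in> {1..T} - {T} \<Longrightarrow>
          AE \<omega> in M. obs_treat Z D s \<omega> \<longrightarrow> obs_treat Z D (s + 1) \<omega>"
    and exclusion0: "\<And>s z. s \<in> {1..T} \<Longrightarrow> AE \<omega> in M. Y0z s z \<omega> = Y0 s \<omega>"
    and exclusion1: "\<And>s \<tau> z. s \<in> {1..T} \<Longrightarrow> \<tau> \<in> {0..s - 1} \<Longrightarrow>
          AE \<omega> in M. Y1z s \<tau> z \<omega> = Y1 s \<tau> \<omega>"
    and independence: "\<And>s. s \<in> {1..T} \<Longrightarrow>
          indep_elements M (potential_space s) (potential_vector D Y0 Y1 s) (count_space UNIV) Z"
    and monotonicity: "prob (DF M D 1) = 0"
begin

text \<open>The information in the potential outcomes and treatments up to \<open>s\<close>. A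
  variable measurable for this \<sigma>-algebra is independent of \<open>Z\<close>, so independence
  is reduced to a measurability check instead of an explicit representation as a function of the
  vector.\<close>

definition hist :: "nat \<Rightarrow> 'a measure" where
  "hist s = vimage_algebra (space M) (potential_vector D Y0 Y1 s) (potential_space s)"

lemma prob_Z_pos: "0 < prob {\<omega> \<in> space M. Z \<omega> = z}"
proof (cases z)
  case False
  then show ?thesis
    using prob_neg[of Z] Z_less by (simp add: pred_def[symmetric])
qed (use Z_pos in simp)

context
  fixes s
  assumes s: "s \<in> {1..T}"
begin

lemma potential_vector_measurable: "potential_vector D Y0 Y1 s \<in> M \<rightarrow>\<^sub>M potential_space s"
  using independence[OF s] by (simp add: indep_elements_def)

lemma potential_vector_hist: "potential_vector D Y0 Y1 s \<in> hist s \<rightarrow>\<^sub>M potential_space s"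
  unfolding hist_def
  by (intro measurable_vimage_algebra1 measurable_space[OF potential_vector_measurable] funcsetI)

lemma Y0_hist: "Y0 s \<in> borel_measurable (hist s)"
proof -
  have "(\<lambda>v. fst v) \<in> potential_space s \<rightarrow>\<^sub>M borel"
    unfolding potential_space_def by measurable
  from measurable_compose[OF potential_vector_hist this] show ?thesis
    by (simp add: potential_vector_def)
qed

lemma Y1_hist:
  assumes "\<tau> < s"
  shows "Y1 s \<tau> \<in> borel_measurable (hist s)"
proof -
  have "(\<lambda>v. fst (snd v) \<tau>) \<in> potential_space s \<rightarrow>\<^sub>M borel"
    unfolding potential_space_def
    by (rule measurable_compose[OF _ measurable_component_singleton[of \<tau> "{..<s}" "\<lambda>_. borel"]])
      (use assms in auto)
  from measurable_compose[OF potential_vector_hist this] show ?thesis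
    using assms by (simp add: potential_vector_def)
qed

lemma D_hist:
  assumes "r \<in> {1..s}"
  shows "Measurable.pred (hist s) (D r z)"
proof -
  have "(\<lambda>v. snd (snd v) (r, z)) \<in> potential_space s \<rightarrow>\<^sub>M count_space UNIV"
    unfolding potential_space_def
    by (rule measurable_compose[OF _ measurable_component_singleton
          [of "(r, z)" "{1..s} \<times> UNIV" "\<lambda>_. count_space UNIV"]]) (use assms in auto)
  from measurable_compose[OF potential_vector_hist this] show ?thesis
    using assms by (simp add: potential_vector_def)
qed

text \<open>The expectation of a product of independent variables factors. The real indicator of
  \<open>Z = z\<close> stands in for \<open>Z\<close>, because \<open>indep_var\<close> requires
  both variables to have the same target type.\<close>

lemma hist_integral:
  assumes X: "X \<in> borel_measurable (hist s)" "integrable M X"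
  shows "(\<integral>\<omega>. X \<omega> * indicator {\<omega> \<in> space M. Z \<omega> = z} \<omega> \<partial>M) = expectation X * prob {\<omega> \<in> space M. Z \<omega> = z}"
proof -
  let ?A = "{\<omega> \<in> space M. Z \<omega> = z}"
  let ?I = "indicator ?A :: 'a \<Rightarrow> real"
  let ?W = "vimage_algebra (space M) Z (count_space UNIV)"
  have [measurable]: "X \<in> borel_measurable M"
    using X(2) by simp
  have "Measurable.pred ?W (\<lambda>\<omega>. Z \<omega> = z)"
    by (rule measurable_compose[OF measurable_vimage_algebra1]) auto
  then have I: "?I \<in> borel_measurable ?W"
    by (intro borel_measurable_indicator) (simp add: pred_def)
  \<comment> \<open>Independence passes to smaller \<sigma>-algebras, and those generated by
    \<open>X\<close> and by the indicator are contained in \<open>hist s\<close> and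
    \<open>?W\<close>.\<close>
  have sub: "sigma_sets (space M) {f -` A \<inter> space M | A. A \<in> sets borel} \<subseteq> sets F"
    if "f \<in> borel_measurable F" "space F = space M" for f :: "'a \<Rightarrow> real" and F
    using that measurable_sets[OF that(1)] sets.sigma_sets_subset[of "{f -` A \<inter> space M | A. A \<in> sets borel}" F]
    by auto
  have "indep_set (sets (hist s)) (sets ?W)"
    using independence[OF s] by (simp add: indep_elements_def hist_def)
  then have "indep_set (sigma_sets (space M) {X -` A \<inter> space M | A. A \<in> sets borel})
      (sigma_sets (space M) {?I -` A \<inter> space M | A. A \<in> sets borel})"
    unfolding indep_set_def
    by (rule indep_sets_mono_sets)
      (use sub[OF X(1)] sub[OF I] in \<open>auto simp: hist_def split: bool.split\<close>)
  then have "indep_var borel X borel ?I"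
    by (simp add: indep_var_eq)
  then have "(\<integral>\<omega>. X \<omega> * ?I \<omega> \<partial>M) = expectation X * expectation ?I"
    by (intro indep_var_lebesgue_integral X integrable_real_indicator) (auto simp: less_top[symmetric])
  then show ?thesis
    by simp
qed

text \<open>On \<open>Z = z\<close> the observed variable \<open>Y\<close> is a potential variable
  \<open>X\<close>, and independence then removes the conditioning. Every passage from observed to
  potential quantities goes through this fact.\<close>

lemma cond_expect_instrument:
  assumes X: "X \<in> borel_measurable (hist s)" "integrable M X"
    and [measurable]: "Y \<in> borel_measurable M" and eq: "AE \<omega> in M. Z \<omega> = z \<longrightarrow> Y \<omega> = X \<omega>"
  shows "cond_expect M Y {\<omega> \<in> space M. Z \<omega> = z} = expectation X"
proof -
  have [measurable]: "X \<in> borel_measurable M"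
    using X(2) by simp
  have "(\<integral>\<omega>. Y \<omega> * indicator {\<omega> \<in> space M. Z \<omega> = z} \<omega> \<partial>M)
      = (\<integral>\<omega>. X \<omega> * indicator {\<omega> \<in> space M. Z \<omega> = z} \<omega> \<partial>M)"
    using eq by (intro integral_cong_AE) (auto elim!: eventually_mono split: split_indicator)
  then show ?thesis
    using prob_Z_pos[of z] by (simp add: cond_expect_eq hist_integral[OF X])
qed

lemma instr_diff_eq:
  assumes X: "\<And>z. X z \<in> borel_measurable (hist s)" "\<And>z. integrable M (X z)"
    and Y: "Y \<in> borel_measurable M" and eq: "AE \<omega> in M. Y \<omega> = X (Z \<omega>) \<omega>"
  shows "instr_diff M Z Y = expectation (X True) - expectation (X False)"
proof -
  have "AE \<omega> in M. Z \<omega> = z \<longrightarrow> Y \<omega> = X z \<omega>" for z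
    using eq by (auto elim: eventually_mono)
  then have "cond_expect M Y {\<omega> \<in> space M. Z \<omega> = z} = expectation (X z)" for z
    by (rule cond_expect_instrument[OF X Y])
  from this[of True] this[of False] show ?thesis
    by (simp add: instr_diff_def)
qed

end

section \<open>Irreversibility of the potential treatments\<close>

lemma prob_as_expectation:
  assumes "Measurable.pred M P"
  shows "expectation (\<lambda>\<omega>. of_bool (P \<omega>) :: real) = \<P>(\<omega> in M. P \<omega>)"
proof -
  have "expectation (\<lambda>\<omega>. of_bool (P \<omega>) :: real) = expectation (indicator {\<omega> \<in> space M. P \<omega>})"
    by (intro Bochner_Integration.integral_cong) auto
  then show ?thesis
    using assms by (simp add: pred_def)
qed

lemma integrable_of_bool:
  assumes [measurable]: "Measurable.pred M P"
  shows "integrable M (\<lambda>\<omega>. of_bool (P \<omega>) :: real)"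
  by (rule integrable_const_bound[of _ 1]) auto

text \<open>On \<open>Z = z\<close> a violation by the potential treatments is an observed
  violation, hence null. Its conditional probability given \<open>Z = z\<close> is thus that of the
  constant 0, and by independence it equals the unconditional one. The vector of period
  \<open>r + 1\<close> is used because it contains both treatments.\<close>

lemma irreversible_potential:
  assumes "1 \<le> r" "r < T"
  shows "AE \<omega> in M. D r z \<omega> \<longrightarrow> D (r + 1) z \<omega>"
proof -
  have s: "r + 1 \<in> {1..T}"
    using assms by simp
  let ?X = "\<lambda>\<omega>. of_bool (D r z \<omega> \<and> \<not> D (r + 1) z \<omega>) :: real"
  have m: "Measurable.pred (hist (r + 1)) (\<lambda>\<omega>. D r z \<omega> \<and> \<not> D (r + 1) z \<omega>)"
      "Measurable.pred M (\<lambda>\<omega>. D r z \<omega> \<and> \<not> D (r + 1) z \<omega>)"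
    using assms by (intro pred_intros_logic D_hist D_meas; simp)+
  have "cond_expect M (\<lambda>_. 0) {\<omega> \<in> space M. Z \<omega> = z} = expectation ?X"
  proof (rule cond_expect_instrument[OF s])
    show "AE \<omega> in M. Z \<omega> = z \<longrightarrow> 0 = ?X \<omega>"
      using irreversible[of r] assms by (auto simp: obs_treat_def elim!: eventually_mono)
  qed (use m integrable_of_bool in auto)
  then have "\<P>(\<omega> in M. D r z \<omega> \<and> \<not> D (r + 1) z \<omega>) = 0"
    using m(2) by (simp add: prob_as_expectation cond_expect_def)
  then show ?thesis
    using m(2) by (subst (asm) prob_eq_0) (auto simp: pred_def elim: eventually_mono)
qed

text \<open>Finitely many one-step statements hold off a common null set, and induction over periods
  chains them. The guard \<open>1 \<le> T\<close> reflects that \<open>D 1\<close> is known to be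
  measurable only when period 1 exists.\<close>

lemma AE_regular:
  "AE \<omega> in M. (\<forall>z r r'. 1 \<le> r \<longrightarrow> r \<le> r' \<longrightarrow> r' \<le> T \<longrightarrow> D r z \<omega> \<longrightarrow> D r' z \<omega>) \<and>
     (1 \<le> T \<longrightarrow> D 1 False \<omega> \<longrightarrow> D 1 True \<omega>)"
proof -
  have "AE \<omega> in M. \<forall>z. \<forall>r\<in>{1..<T}. D r z \<omega> \<longrightarrow> D (r + 1) z \<omega>"
    unfolding AE_all_countable AE_ball_countable[OF countable_finite[OF finite_atLeastLessThan]]
    using irreversible_potential by simp
  moreover have "AE \<omega> in M. 1 \<le> T \<longrightarrow> D 1 False \<omega> \<longrightarrow> D 1 True \<omega>"
  proof (cases "1 \<le> T")
    case True
    then have [measurable]: "Measurable.pred M (D 1 z)" for z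
      by (intro D_meas) simp
    have "DF M D 1 \<in> events"
      unfolding DF_def by measurable
    then show ?thesis
      using monotonicity by (auto simp: prob_eq_0 DF_def elim: eventually_mono)
  qed simp
  ultimately show ?thesis
  proof eventually_elim
    case (elim \<omega>)
    have "D r' z \<omega>" if "r \<le> r'" "1 \<le> r" "r' \<le> T" "D r z \<omega>" for z r r'
      using that by (induction r' rule: dec_induct) (use elim in auto)
    then show ?case
      using elim by blast
  qed
qed

lemma pred_obs_treat: "s \<in> {1..T} \<Longrightarrow> Measurable.pred M (obs_treat Z D s)"
proof -
  assume "s \<in> {1..T}"
  note [measurable] = D_meas[OF this]
  have "obs_treat Z D s = (\<lambda>\<omega>. if Z \<omega> then D s True \<omega> else D s False \<omega>)"
    by (auto simp: obs_treat_def fun_eq_iff)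
  then show ?thesis
    by simp
qed

lemma onset_hist: "t \<in> {1..T} \<Longrightarrow> s \<in> {1..t} \<Longrightarrow> Measurable.pred (hist t) (onset D s z)"
  by (intro pred_onset D_hist) auto

lemma onset_meas: "s \<in> {1..T} \<Longrightarrow> Measurable.pred M (onset D s z)"
  by (intro pred_onset D_meas) auto

section \<open>Estimands in terms of potential variables\<close>

lemma first_stage_eq:
  assumes s: "s \<in> {1..T}"
  shows "first_stage M Z D s = \<P>(\<omega> in M. D s True \<omega>) - \<P>(\<omega> in M. D s False \<omega>)"
proof -
  have "first_stage M Z D s =
      expectation (\<lambda>\<omega>. of_bool (D s True \<omega>)) - expectation (\<lambda>\<omega>. of_bool (D s False \<omega>))"
    unfolding first_stage_def
  proof (rule instr_diff_eq[OF s, where X = "\<lambda>z \<omega>. of_bool (D s z \<omega>)"])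
    show "(\<lambda>\<omega>. of_bool (D s z \<omega>) :: real) \<in> borel_measurable (hist s)" for z
      using D_hist[OF s, of s z] s by simp
    show "(\<lambda>\<omega>. of_bool (obs_treat Z D s \<omega>) :: real) \<in> borel_measurable M"
      using pred_obs_treat[OF s] by simp
  qed (use D_meas[OF s] in \<open>auto simp: obs_treat_def intro: integrable_of_bool\<close>)
  then show ?thesis
    using D_meas[OF s] by (simp add: prob_as_expectation)
qed

lemma integrable_effect: "t \<in> {1..T} \<Longrightarrow> \<tau> < t \<Longrightarrow> integrable M (\<lambda>\<omega>. Y1 t \<tau> \<omega> - Y0 t \<omega>)"
  by (intro Bochner_Integration.integrable_diff Y1_int Y0_int) auto

lemma integrable_of_bool_mult:
  assumes [measurable]: "Measurable.pred M P" and W: "integrable M (W :: 'a \<Rightarrow> real)"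
  shows "integrable M (\<lambda>\<omega>. of_bool (P \<omega>) * W \<omega>)"
proof (rule Bochner_Integration.integrable_bound[OF W])
  note [measurable] = borel_measurable_integrable[OF W]
  show "(\<lambda>\<omega>. of_bool (P \<omega>) * W \<omega>) \<in> borel_measurable M"
    by measurable
qed (simp add: of_bool_def)

lemma reduced_form_eq:
  assumes t: "t \<in> {1..T}"
  shows "reduced_form M Z D Y0z Y1z t =
    (\<Sum>s=1..t. \<integral>\<omega>. (of_bool (onset D s True \<omega>) - of_bool (onset D s False \<omega>)) * (Y1 t (t - s) \<omega> - Y0 t \<omega>) \<partial>M)"
proof -
  \<comment> \<open>\<open>X z\<close> is the outcome that would be observed under instrument value
    \<open>z\<close>, with exclusion already applied. Its baseline \<open>Y0 t\<close> is common to
    both arms and cancels in the difference.\<close>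
  define X where "X z \<omega> = Y0 t \<omega> + (\<Sum>s=1..t. of_bool (onset D s z \<omega>) * (Y1 t (t - s) \<omega> - Y0 t \<omega>))" for z \<omega>
  have int: "integrable M (\<lambda>\<omega>. of_bool (onset D s z \<omega>) * (Y1 t (t - s) \<omega> - Y0 t \<omega>))" if "s \<in> {1..t}" for s z
    using that t by (intro integrable_of_bool_mult onset_meas integrable_effect) auto
  have X_int: "integrable M (X z)" for z
    unfolding X_def [abs_def]
    by (intro Bochner_Integration.integrable_add Bochner_Integration.integrable_sum Y0_int t int)
  have X_eq: "expectation (X z) =
      expectation (Y0 t) + (\<Sum>s=1..t. \<integral>\<omega>. of_bool (onset D s z \<omega>) * (Y1 t (t - s) \<omega> - Y0 t \<omega>) \<partial>M)" for z
    unfolding X_def [abs_def]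
    by (simp only: Bochner_Integration.integral_add[OF Y0_int[OF t] Bochner_Integration.integrable_sum[OF int]]
        Bochner_Integration.integral_sum[OF int])
  have "reduced_form M Z D Y0z Y1z t = expectation (X True) - expectation (X False)"
    unfolding reduced_form_def
  proof (rule instr_diff_eq[OF t _ X_int])
    show "X z \<in> borel_measurable (hist t)" for z
      unfolding X_def [abs_def] using t
      by (intro borel_measurable_add borel_measurable_sum borel_measurable_times borel_measurable_diff
          Y0_hist Y1_hist measurable_compose[OF onset_hist[OF t] borel_measurable_count_space]) auto
    \<comment> \<open>The same expression before exclusion: it equals the observed outcome
      everywhere, which gives measurability, and it agrees with \<open>X\<close> almost
      surely.\<close>
    define Q where "Q z \<omega> = Y0z t z \<omega> +
      (\<Sum>s=1..t. of_bool (onset D s z \<omega>) * (Y1z t (t - s) z \<omega> - Y0z t z \<omega>))" for z \<omega>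
    have Q: "obs_outcome Z D Y0z Y1z t \<omega> = Q (Z \<omega>) \<omega>" for \<omega>
      unfolding Q_def by (rule obs_outcome_eq_sum)
    have [measurable]: "Q z \<in> borel_measurable M" for z
      unfolding Q_def [abs_def] using t
      by (intro borel_measurable_add borel_measurable_sum borel_measurable_times borel_measurable_diff
          measurable_compose[OF onset_meas borel_measurable_count_space]
          borel_measurable_integrable[OF Y0z_int] borel_measurable_integrable[OF Y1z_int]) auto
    have "obs_outcome Z D Y0z Y1z t = (\<lambda>\<omega>. if Z \<omega> then Q True \<omega> else Q False \<omega>)"
      by (auto simp: Q fun_eq_iff)
    then show "obs_outcome Z D Y0z Y1z t \<in> borel_measurable M"
      by simp
    have "AE \<omega> in M. \<forall>z. Y0z t z \<omega> = Y0 t \<omega>"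
      unfolding AE_all_countable using exclusion0[OF t] by blast
    moreover have "AE \<omega> in M. \<forall>z. \<forall>\<tau>\<in>{0..t - 1}. Y1z t \<tau> z \<omega> = Y1 t \<tau> \<omega>"
      unfolding AE_all_countable AE_ball_countable[OF countable_finite[OF finite_atLeastAtMost]]
      using exclusion1[OF t] by blast
    ultimately show "AE \<omega> in M. obs_outcome Z D Y0z Y1z t \<omega> = X (Z \<omega>) \<omega>"
    proof eventually_elim
      case (elim \<omega>)
      have "Y1z t (t - s) z \<omega> = Y1 t (t - s) \<omega>" if "s \<in> {1..t}" for s z
        using that elim by auto
      then show ?case
        using elim by (simp add: Q Q_def X_def)
    qed
  qed
  also have "\<dots> = (\<Sum>s=1..t. (\<integral>\<omega>. of_bool (onset D s True \<omega>) * (Y1 t (t - s) \<omega> - Y0 t \<omega>) \<partial>M)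
      - (\<integral>\<omega>. of_bool (onset D s False \<omega>) * (Y1 t (t - s) \<omega> - Y0 t \<omega>) \<partial>M))"
    by (simp only: X_eq sum_subtractf add_diff_cancel_left)
  also have "\<dots> = (\<Sum>s=1..t. \<integral>\<omega>. (of_bool (onset D s True \<omega>) - of_bool (onset D s False \<omega>)) * (Y1 t (t - s) \<omega> - Y0 t \<omega>) \<partial>M)"
    unfolding left_diff_distrib
    by (intro sum.cong refl Bochner_Integration.integral_diff[symmetric] int)
  finally show ?thesis .
qed

lemma prob_treated_between:
  assumes "1 \<le> r" "r \<le> s" "s \<le> T"
  shows "\<P>(\<omega> in M. D s z \<omega> \<and> \<not> D r z \<omega>) = \<P>(\<omega> in M. D s z \<omega>) - \<P>(\<omega> in M. D r z \<omega>)"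
proof -
  have [measurable]: "Measurable.pred M (D s z)" "Measurable.pred M (D r z)"
    using assms by (auto intro: D_meas)
  have "expectation (\<lambda>\<omega>. of_bool (D s z \<omega> \<and> \<not> D r z \<omega>)) =
      (\<integral>\<omega>. of_bool (D s z \<omega>) - of_bool (D r z \<omega>) \<partial>M :: real)"
    using AE_regular assms by (intro integral_cong_AE) (auto elim!: eventually_mono)
  also have "\<dots> = expectation (\<lambda>\<omega>. of_bool (D s z \<omega>)) - expectation (\<lambda>\<omega>. of_bool (D r z \<omega>))"
    by (intro Bochner_Integration.integral_diff integrable_of_bool) auto
  finally show ?thesis
    by (simp add: prob_as_expectation)
qed

text \<open>By irreversibility, almost surely no treatment before \<open>s\<close> means no
  treatment at \<open>s - 1\<close>, so onset probabilities are increments of treatment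
  probabilities and telescope over \<open>s\<close>.\<close>

lemma prob_onset:
  assumes "2 \<le> s" "s \<le> T"
  shows "\<P>(\<omega> in M. onset D s z \<omega>) = \<P>(\<omega> in M. D s z \<omega>) - \<P>(\<omega> in M. D (s - 1) z \<omega>)"
proof -
  have [measurable]: "Measurable.pred M (D s z)" "Measurable.pred M (D (s - 1) z)"
      "Measurable.pred M (onset D s z)"
    using assms by (auto intro!: D_meas onset_meas)
  have "\<P>(\<omega> in M. onset D s z \<omega>) = \<P>(\<omega> in M. D s z \<omega> \<and> \<not> D (s - 1) z \<omega>)"
  proof (rule measure_eq_AE)
    show "AE \<omega> in M. \<omega> \<in> {\<omega> \<in> space M. onset D s z \<omega>} \<longleftrightarrow> \<omega> \<in> {\<omega> \<in> space M. D s z \<omega> \<and> \<not> D (s - 1) z \<omega>}"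
      using AE_regular
    proof eventually_elim
      case (elim \<omega>)
      have "D (s - 1) z \<omega>" if "1 \<le> r" "r < s" "D r z \<omega>" for r
      proof -
        have "1 \<le> r" "r \<le> s - 1" "s - 1 \<le> T" using that assms by auto
        then show ?thesis using elim that(3) by blast
      qed
      moreover have "s - 1 \<in> {1..<s}"
        using assms by auto
      ultimately have "onset D s z \<omega> \<longleftrightarrow> D s z \<omega> \<and> \<not> D (s - 1) z \<omega>"
        unfolding onset_def by (metis atLeastLessThan_iff)
      then show ?case
        by simp
    qed
  qed measurable
  then show ?thesis
    using assms by (simp add: prob_treated_between)
qed

lemma cond_prob_late_treatment:
  assumes t: "t \<in> {1..T}"
  shows "\<P>(\<omega> in M. obs_treat Z D t \<omega> > obs_treat Z D 1 \<omega> \<bar> Z \<omega> = z) =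
    \<P>(\<omega> in M. D t z \<omega>) - \<P>(\<omega> in M. D 1 z \<omega>)"
proof -
  have T1: "1 \<in> {1..T}" "1 \<in> {1..t}" "t \<in> {1..t}"
    using t by auto
  let ?P = "\<lambda>\<omega>. obs_treat Z D t \<omega> \<and> \<not> obs_treat Z D 1 \<omega>"
  let ?X = "\<lambda>\<omega>. of_bool (D t z \<omega> \<and> \<not> D 1 z \<omega>) :: real"
  have [measurable]: "Measurable.pred M (obs_treat Z D t)" "Measurable.pred M (obs_treat Z D 1)"
      "Measurable.pred M (D t z)" "Measurable.pred M (D 1 z)"
    using pred_obs_treat D_meas t T1 by blast+
  have "\<P>(\<omega> in M. obs_treat Z D t \<omega> > obs_treat Z D 1 \<omega> \<bar> Z \<omega> = z) =
      \<P>(\<omega> in M. ?P \<omega> \<and> Z \<omega> = z) / prob {\<omega> \<in> space M. Z \<omega> = z}"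
    by (simp add: cond_prob_def conj_commute)
  also have "\<P>(\<omega> in M. ?P \<omega> \<and> Z \<omega> = z) = expectation (\<lambda>\<omega>. of_bool (?P \<omega> \<and> Z \<omega> = z))"
    by (rule prob_as_expectation[symmetric]) measurable
  also have "\<dots> = (\<integral>\<omega>. of_bool (?P \<omega>) * indicator {\<omega> \<in> space M. Z \<omega> = z} \<omega> \<partial>M)"
    by (intro Bochner_Integration.integral_cong) (auto split: split_indicator)
  also have "\<dots> / prob {\<omega> \<in> space M. Z \<omega> = z} = cond_expect M (\<lambda>\<omega>. of_bool (?P \<omega>)) {\<omega> \<in> space M. Z \<omega> = z}"
    using prob_Z_pos[of z] by (intro cond_expect_eq[symmetric]) measurable
  also have "\<dots> = expectation ?X"
  proof (rule cond_expect_instrument[OF t])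
    have "Measurable.pred (hist t) (\<lambda>\<omega>. D t z \<omega> \<and> \<not> D 1 z \<omega>)"
      by (intro pred_intros_logic D_hist[OF t] T1)
    then show "?X \<in> borel_measurable (hist t)"
      by simp
    show "integrable M ?X"
      by (intro integrable_of_bool) measurable
    show "(\<lambda>\<omega>. of_bool (?P \<omega>) :: real) \<in> borel_measurable M"
      by measurable
  qed (simp add: obs_treat_def)
  also have "\<dots> = \<P>(\<omega> in M. D t z \<omega> \<and> \<not> D 1 z \<omega>)"
    by (rule prob_as_expectation) measurable
  finally show ?thesis
    using t by (simp add: prob_treated_between)
qed

section \<open>Switching between the arms, in the first and in later periods\<close>

lemma onset_diff_integral:
  assumes s: "s \<in> {1..T}"
  shows "(\<integral>\<omega>. of_bool (onset D s True \<omega>) - of_bool (onset D s False \<omega>) \<partial>M :: real) =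
    \<P>(\<omega> in M. onset D s True \<omega>) - \<P>(\<omega> in M. onset D s False \<omega>)"
  unfolding prob_as_expectation[OF onset_meas[OF s], symmetric]
  by (intro Bochner_Integration.integral_diff integrable_of_bool onset_meas s)

lemma CO_1_events: "1 \<le> T \<Longrightarrow> CO M D 1 \<in> events"
proof -
  assume "1 \<le> T"
  then have [measurable]: "Measurable.pred M (D 1 z)" for z
    by (intro D_meas) auto
  show ?thesis
    unfolding CO_def by measurable
qed

text \<open>Without defiers at period 1 the two indicators differ exactly on the compliers. Taking
  \<open>W\<close> constantly 1 gives the first stage, and taking \<open>W\<close> to be the effect
  gives the leading term of the reduced form.\<close>

lemma first_period_integral:
  fixes W :: "'a \<Rightarrow> real"
  assumes T: "1 \<le> T" and [measurable]: "W \<in> borel_measurable M"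
  shows "(\<integral>\<omega>. (of_bool (onset D 1 True \<omega>) - of_bool (onset D 1 False \<omega>)) * W \<omega> \<partial>M) =
    (\<integral>\<omega>. W \<omega> * indicator (CO M D 1) \<omega> \<partial>M)"
proof (rule integral_cong_AE)
  note [measurable] = CO_1_events[OF T]
  show "AE \<omega> in M. (of_bool (onset D 1 True \<omega>) - of_bool (onset D 1 False \<omega>)) * W \<omega> =
      W \<omega> * indicator (CO M D 1) \<omega>"
    using AE_regular AE_space
  proof eventually_elim
    case (elim \<omega>)
    then show ?case
      using T by (auto simp: CO_def)
  qed
  have [measurable]: "Measurable.pred M (onset D 1 z)" for z
    using T by (intro onset_meas) auto
  show "(\<lambda>\<omega>. (of_bool (onset D 1 True \<omega>) - of_bool (onset D 1 False \<omega>)) * W \<omega>) \<in> borel_measurable M"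
    by measurable
  show "(\<lambda>\<omega>. W \<omega> * indicator (CO M D 1) \<omega>) \<in> borel_measurable M"
    by measurable
qed

lemma first_stage_1: "1 \<le> T \<Longrightarrow> first_stage M Z D 1 = prob (CO M D 1)"
proof -
  assume T: "1 \<le> T"
  have "first_stage M Z D 1 = (\<integral>\<omega>. (of_bool (onset D 1 True \<omega>) - of_bool (onset D 1 False \<omega>)) * 1 \<partial>M)"
    using onset_diff_integral[of 1] T by (simp add: first_stage_eq)
  also have "\<dots> = (\<integral>\<omega>. 1 * indicator (CO M D 1) \<omega> \<partial>M)"
    by (rule first_period_integral[OF T]) simp
  also have "\<dots> = prob (CO M D 1)"
    using CO_1_events[OF T] by simp
  finally show ?thesis .
qed

lemma switching_groups:
  assumes s: "2 \<le> s" "s \<le> T"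
  shows "AE \<omega> in M. of_bool (onset D s True \<omega>) - of_bool (onset D s False \<omega>) =
    (indicator (\<Union>(groups_plus M D s)) \<omega> - indicator (\<Union>(groups_minus M D s)) \<omega> :: real)"
  using AE_regular AE_space
proof eventually_elim
  case (elim \<omega>)
  have mono: "D r' z \<omega>" if "1 \<le> r" "r \<le> r'" "r' \<le> s" "D r z \<omega>" for z r r'
  proof -
    have "r' \<le> T" using that s by simp
    then show ?thesis using elim(1) that by blast
  qed
  have "\<omega> \<in> \<Union>(groups_plus M D s) \<longleftrightarrow> onset D s True \<omega> \<and> \<not> onset D s False \<omega>"
    unfolding groups_plus_eq
  proof
    assume "\<omega> \<in> \<Union>(arm_groups M D True s {2..s - 1})"
    from Union_arm_groups_subset[OF _ this] show "onset D s True \<omega> \<and> \<not> onset D s False \<omega>"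
      by simp
  next
    assume "onset D s True \<omega> \<and> \<not> onset D s False \<omega>"
    then have on: "onset D s True \<omega>" "\<not> onset D s (\<not> True) \<omega>"
      by simp_all
    show "\<omega> \<in> \<Union>(arm_groups M D True s {2..s - 1})"
    proof (rule onset_in_Union_arm_groups[OF \<open>\<omega> \<in> space M\<close> _ mono _ _ on])
      \<comment> \<open>The claim is vacuous: such a point would be a defier at period 1, excluded
        by \<open>AE_regular\<close>.\<close>
      show "1 \<in> {2..s - 1}" if "D 1 (\<not> True) \<omega>" "\<not> D 1 True \<omega>"
        using that elim s by simp
    qed (use s in auto)
  qed
  moreover have "\<omega> \<in> \<Union>(groups_minus M D s) \<longleftrightarrow> onset D s False \<omega> \<and> \<not> onset D s True \<omega>"
    unfolding groups_minus_eq[OF s(1)]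
  proof
    assume "\<omega> \<in> \<Union>(arm_groups M D False s {1..s - 1})"
    from Union_arm_groups_subset[OF _ this] show "onset D s False \<omega> \<and> \<not> onset D s True \<omega>"
      by simp
  next
    assume "onset D s False \<omega> \<and> \<not> onset D s True \<omega>"
    then have on: "onset D s False \<omega>" "\<not> onset D s (\<not> False) \<omega>"
      by simp_all
    show "\<omega> \<in> \<Union>(arm_groups M D False s {1..s - 1})"
    proof (rule onset_in_Union_arm_groups[OF \<open>\<omega> \<in> space M\<close> _ mono _ _ on])
      show "1 \<in> {1..s - 1}" if "D 1 (\<not> False) \<omega>" "\<not> D 1 False \<omega>"
        using that elim s by simp
    qed (use s in auto)
  qed
  ultimately show ?case
    by (auto simp: indicator_def)
qed

context
  fixes s
  assumes s: "2 \<le> s" "s \<le> T"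
begin

lemma groups_events: "groups_plus M D s \<subseteq> events" "groups_minus M D s \<subseteq> events"
  unfolding groups_plus_eq groups_minus_eq[OF s(1)]
proof -
  have D: "Measurable.pred M (D r z)" if "r \<in> {1..s}" for r z
    using that s by (intro D_meas) auto
  show "arm_groups M D True s {2..s - 1} \<subseteq> events"
    by (rule arm_groups_events[OF _ s(1) D]) auto
  show "arm_groups M D False s {1..s - 1} \<subseteq> events"
    by (rule arm_groups_events[OF _ s(1) D]) auto
qed

lemma finite_groups: "finite (groups_plus M D s)" "finite (groups_minus M D s)"
  unfolding groups_plus_eq groups_minus_eq[OF s(1)] by (simp_all add: finite_arm_groups)

lemma disjoint_groups: "disjoint (groups_plus M D s)" "disjoint (groups_minus M D s)"
  unfolding groups_plus_eq groups_minus_eq[OF s(1)] by (auto intro!: disjoint_arm_groups)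

lemma Union_groups_events: "\<Union>(groups_plus M D s) \<in> events" "\<Union>(groups_minus M D s) \<in> events"
  using groups_events finite_groups by (auto intro: sets.finite_Union)

text \<open>Points whose onset is \<open>s\<close> under both instrument values belong to no group,
  hence only an inequality.\<close>

lemma prob_Union_groups_le:
  "prob (\<Union>(groups_plus M D s)) \<le> \<P>(\<omega> in M. onset D s True \<omega>)"
  "prob (\<Union>(groups_minus M D s)) \<le> \<P>(\<omega> in M. onset D s False \<omega>)"
proof -
  have [measurable]: "Measurable.pred M (onset D s z)" for z
    using s by (auto intro: onset_meas)
  have "\<Union>(groups_plus M D s) \<subseteq> {\<omega> \<in> space M. onset D s True \<omega>}"
    using Union_arm_groups_subset[of "{2..s - 1}" s _ M D True] sets.sets_into_space[OF Union_groups_events(1)]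
    unfolding groups_plus_eq by fastforce
  moreover have "\<Union>(groups_minus M D s) \<subseteq> {\<omega> \<in> space M. onset D s False \<omega>}"
    using Union_arm_groups_subset[of "{1..s - 1}" s _ M D False] sets.sets_into_space[OF Union_groups_events(2)]
    unfolding groups_minus_eq[OF s(1)] by fastforce
  ultimately show "prob (\<Union>(groups_plus M D s)) \<le> \<P>(\<omega> in M. onset D s True \<omega>)"
      "prob (\<Union>(groups_minus M D s)) \<le> \<P>(\<omega> in M. onset D s False \<omega>)"
    by (auto intro!: finite_measure_mono)
qed

lemma switching_integral:
  fixes W :: "'a \<Rightarrow> real"
  assumes W: "integrable M W"
  shows "(\<integral>\<omega>. (of_bool (onset D s True \<omega>) - of_bool (onset D s False \<omega>)) * W \<omega> \<partial>M) =
    (\<integral>\<omega>. W \<omega> * indicator (\<Union>(groups_plus M D s)) \<omega> \<partial>M) - (\<integral>\<omega>. W \<omega> * indicator (\<Union>(groups_minus M D s)) \<omega> \<partial>M)"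
proof -
  note [measurable] = Union_groups_events borel_measurable_integrable[OF W]
  have [measurable]: "Measurable.pred M (onset D s z)" for z
    using s by (auto intro: onset_meas)
  have "(\<integral>\<omega>. (of_bool (onset D s True \<omega>) - of_bool (onset D s False \<omega>)) * W \<omega> \<partial>M) =
    (\<integral>\<omega>. W \<omega> * indicator (\<Union>(groups_plus M D s)) \<omega> - W \<omega> * indicator (\<Union>(groups_minus M D s)) \<omega> \<partial>M)"
  proof (rule integral_cong_AE)
    show "AE \<omega> in M. (of_bool (onset D s True \<omega>) - of_bool (onset D s False \<omega>)) * W \<omega> =
        W \<omega> * indicator (\<Union>(groups_plus M D s)) \<omega> - W \<omega> * indicator (\<Union>(groups_minus M D s)) \<omega>"
      using switching_groups[OF s] by eventually_elim (simp only: left_diff_distrib mult.commute[of "W _"])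
  qed measurable
  then show ?thesis
    by (simp only: Bochner_Integration.integral_diff[OF integrable_real_mult_indicator[OF _ W]
          integrable_real_mult_indicator[OF _ W]] Union_groups_events)
qed

text \<open>The points with onset \<open>s\<close> in both arms cancel in the difference, so here
  equality holds; this is the case of a constant \<open>W\<close>.\<close>

lemma prob_Union_groups_diff:
  "prob (\<Union>(groups_plus M D s)) - prob (\<Union>(groups_minus M D s)) =
    \<P>(\<omega> in M. onset D s True \<omega>) - \<P>(\<omega> in M. onset D s False \<omega>)"
proof -
  have "prob A = (\<integral>\<omega>. 1 * indicator A \<omega> \<partial>M)" if "A \<in> events" for A
    using that by simp
  then show ?thesis
    using switching_integral[of "\<lambda>_. 1"] onset_diff_integral[of s] s Union_groups_events
    by (simp only: mult_1_right integrable_const) simp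
qed

text \<open>The signs of \<open>lo\<close> and \<open>hi\<close> allow the group probabilities to be
  replaced by the larger onset probabilities, which only widens the bounds.\<close>

lemma switching_integral_bounds:
  assumes W: "integrable M W" and sign: "lo \<le> 0" "0 \<le> hi"
    and bounds: "\<And>g. g \<in> groups M D s \<Longrightarrow> 0 < prob g \<Longrightarrow> lo \<le> cond_expect M W g \<and> cond_expect M W g \<le> hi"
  defines "I \<equiv> (\<integral>\<omega>. (of_bool (onset D s True \<omega>) - of_bool (onset D s False \<omega>)) * W \<omega> \<partial>M)"
  shows "lo * \<P>(\<omega> in M. onset D s True \<omega>) - hi * \<P>(\<omega> in M. onset D s False \<omega>) \<le> I"
    and "I \<le> hi * \<P>(\<omega> in M. onset D s True \<omega>) - lo * \<P>(\<omega> in M. onset D s False \<omega>)"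
proof -
  note plus = integral_Union_bounds[OF finite_groups(1) disjoint_groups(1) groups_events(1) W bounds]
  note minus = integral_Union_bounds[OF finite_groups(2) disjoint_groups(2) groups_events(2) W bounds]
  note bds = plus[unfolded groups_def, OF UnI1] minus[unfolded groups_def, OF UnI2]
  show "lo * \<P>(\<omega> in M. onset D s True \<omega>) - hi * \<P>(\<omega> in M. onset D s False \<omega>) \<le> I"
    unfolding I_def switching_integral[OF W]
    using bds mult_left_mono_neg[OF prob_Union_groups_le(1) sign(1)] mult_left_mono[OF prob_Union_groups_le(2) sign(2)]
    by linarith
  show "I \<le> hi * \<P>(\<omega> in M. onset D s True \<omega>) - lo * \<P>(\<omega> in M. onset D s False \<omega>)"
    unfolding I_def switching_integral[OF W]
    using bds mult_left_mono_neg[OF prob_Union_groups_le(2) sign(1)] mult_left_mono[OF prob_Union_groups_le(1) sign(2)]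
    by linarith
qed

text \<open>With \<open>lo = hi = \<delta>\<close> the bounds collapse, leaving \<delta> times the
  difference of the group probabilities, which is known exactly.\<close>

lemma switching_integral_homogeneous:
  assumes W: "integrable M W"
    and eq: "\<And>g. g \<in> groups M D s \<Longrightarrow> 0 < prob g \<Longrightarrow> cond_expect M W g = \<delta>"
  shows "(\<integral>\<omega>. (of_bool (onset D s True \<omega>) - of_bool (onset D s False \<omega>)) * W \<omega> \<partial>M) =
    \<delta> * (\<P>(\<omega> in M. onset D s True \<omega>) - \<P>(\<omega> in M. onset D s False \<omega>))"
proof -
  have bounds: "\<delta> \<le> cond_expect M W g \<and> cond_expect M W g \<le> \<delta>" if "g \<in> groups M D s" "0 < prob g" for g
    using eq[OF that] by simp
  note plus = integral_Union_bounds[OF finite_groups(1) disjoint_groups(1) groups_events(1) W bounds]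
  note minus = integral_Union_bounds[OF finite_groups(2) disjoint_groups(2) groups_events(2) W bounds]
  note bds = plus[unfolded groups_def, OF UnI1] minus[unfolded groups_def, OF UnI2]
  show ?thesis
    unfolding switching_integral[OF W] prob_Union_groups_diff[symmetric]
    using bds by (simp add: right_diff_distrib)
qed

end

end

section \<open>Assembly of the bounds\<close>

theorem proposition3p3:
  fixes M :: "'a measure" and T t :: nat
    and Z :: "'a \<Rightarrow> bool" and D :: "nat \<Rightarrow> bool \<Rightarrow> 'a \<Rightarrow> bool"
    and Y0z :: "nat \<Rightarrow> bool \<Rightarrow> 'a \<Rightarrow> real" and Y1z :: "nat \<Rightarrow> nat \<Rightarrow> bool \<Rightarrow> 'a \<Rightarrow> real"
    and Y0 :: "nat \<Rightarrow> 'a \<Rightarrow> real" and Y1 :: "nat \<Rightarrow> nat \<Rightarrow> 'a \<Rightarrow> real"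
    and \<Delta>lo \<Delta>hi :: real
  assumes prob: "prob_space M"
    and Z_meas: "Z \<in> M \<rightarrow>\<^sub>M count_space UNIV"
    and Z_pos: "0 < \<P>(\<omega> in M. Z \<omega>)" and Z_less: "\<P>(\<omega> in M. Z \<omega>) < 1"
    and D_meas: "\<And>s z. s \<in> {1..T} \<Longrightarrow> D s z \<in> M \<rightarrow>\<^sub>M count_space UNIV"
    and Y0z_int: "\<And>s z. s \<in> {1..T} \<Longrightarrow> integrable M (Y0z s z)"
    and Y1z_int: "\<And>s \<tau> z. s \<in> {1..T} \<Longrightarrow> \<tau> \<in> {0..s - 1} \<Longrightarrow> integrable M (Y1z s \<tau> z)"
    and Y0_int: "\<And>s. s \<in> {1..T} \<Longrightarrow> integrable M (Y0 s)"
    and Y1_int: "\<And>s \<tau>. s \<in> {1..T} \<Longrightarrow> \<tau> \<in> {0..s - 1} \<Longrightarrow> integrable M (Y1 s \<tau>)"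
    and irreversible: "\<And>s. s \<in> {1..T} - {T} \<Longrightarrow>
          AE \<omega> in M. obs_treat Z D s \<omega> \<longrightarrow> obs_treat Z D (s + 1) \<omega>"
    and exclusion0: "\<And>s z. s \<in> {1..T} \<Longrightarrow> AE \<omega> in M. Y0z s z \<omega> = Y0 s \<omega>"
    and exclusion1: "\<And>s \<tau> z. s \<in> {1..T} \<Longrightarrow> \<tau> \<in> {0..s - 1} \<Longrightarrow>
          AE \<omega> in M. Y1z s \<tau> z \<omega> = Y1 s \<tau> \<omega>"
    and independence: "\<And>s. s \<in> {1..T} \<Longrightarrow>
          indep_elements M (potential_space s) (potential_vector D Y0 Y1 s) (count_space UNIV) Z"
    and relevance: "first_stage M Z D 1 \<noteq> 0"
    and monotonicity: "measure M (DF M D 1) = 0"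
    and t: "t \<in> {1..T} - {1}"
    and bounds_sign: "\<Delta>lo \<le> 0" "0 \<le> \<Delta>hi"
    and bounds: "\<And>\<tau> g. \<tau> \<in> {0..t - 2} \<Longrightarrow> g \<in> groups M D (t - \<tau>) \<Longrightarrow> measure M g > 0 \<Longrightarrow>
          \<Delta>lo \<le> effect M Y0 Y1 t \<tau> g \<and> effect M Y0 Y1 t \<tau> g \<le> \<Delta>hi"
  shows
    "let RF = reduced_form M Z D Y0z Y1z;
         FS = first_stage M Z D;
         p0 = \<P>(\<omega> in M. obs_treat Z D t \<omega> > obs_treat Z D 1 \<omega> \<bar> \<not> Z \<omega>);
         p1 = \<P>(\<omega> in M. obs_treat Z D t \<omega> > obs_treat Z D 1 \<omega> \<bar> Z \<omega>);
         \<Delta>C = effect M Y0 Y1 t (t - 1) (CO M D 1);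
         L = RF t / FS 1 + p0 * (\<Delta>lo / FS 1) - p1 * (\<Delta>hi / FS 1);
         U = RF t / FS 1 + p0 * (\<Delta>hi / FS 1) - p1 * (\<Delta>lo / FS 1);
         S = (\<Sum>k = 2..t. of_bool (FS (k - 1) < FS k) * ((FS (k - 1) - FS k) / FS 1));
         Ls = RF t / FS 1 + \<Delta>lo * ((FS 1 - FS t) / FS 1) + (\<Delta>hi - \<Delta>lo) * S;
         Us = RF t / FS 1 + \<Delta>hi * ((FS 1 - FS t) / FS 1) + (\<Delta>lo - \<Delta>hi) * S
     in (L \<le> \<Delta>C \<and> \<Delta>C \<le> U) \<and>
        ((\<forall>\<tau>\<in>{0..t - 2}. \<forall>g\<in>groups M D (t - \<tau>). \<forall>g'\<in>groups M D (t - \<tau>).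
            measure M g > 0 \<longrightarrow> measure M g' > 0 \<longrightarrow>
            effect M Y0 Y1 t \<tau> g = effect M Y0 Y1 t \<tau> g')
         \<longrightarrow> Ls \<le> \<Delta>C \<and> \<Delta>C \<le> Us \<and> L \<le> Ls \<and> Us \<le> U)"
proof -
  interpret staggered_iv M T Z D Y0z Y1z Y0 Y1
    by (rule staggered_iv.intro[OF prob staggered_iv_axioms.intro[OF Z_meas Z_pos Z_less D_meas
      Y0z_int Y1z_int Y0_int Y1_int irreversible exclusion0 exclusion1 independence monotonicity]])
  have tT: "2 \<le> t" "t \<le> T" "t \<in> {1..T}" "1 \<in> {1..T}"
    using t by auto
  define FS where "FS = first_stage M Z D"
  define e where "e k z = \<P>(\<omega> in M. onset D k z \<omega>)" for k z
  define I where "I k = (\<integral>\<omega>. (of_bool (onset D k True \<omega>) - of_bool (onset D k False \<omega>)) *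
      (Y1 t (t - k) \<omega> - Y0 t \<omega>) \<partial>M)" for k
  define RF where "RF = reduced_form M Z D Y0z Y1z"
  define \<Delta>C where "\<Delta>C = effect M Y0 Y1 t (t - 1) (CO M D 1)"
  define p where "p z = \<P>(\<omega> in M. obs_treat Z D t \<omega> > obs_treat Z D 1 \<omega> \<bar> Z \<omega> = z)" for z
  define x where "x k = FS k - FS (k - 1)" for k
  have FS1: "FS 1 = prob (CO M D 1)"
    unfolding FS_def using tT by (intro first_stage_1) auto
  then have c: "0 < FS 1"
    using relevance by (simp add: FS_def zero_less_measure_iff)
  have W: "integrable M (\<lambda>\<omega>. Y1 t (t - k) \<omega> - Y0 t \<omega>)" if "1 \<le> k" for k
    using that tT by (intro integrable_effect) auto
  have "I 1 = \<Delta>C * FS 1"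
    unfolding I_def \<Delta>C_def FS1 effect_def
    using tT borel_measurable_integrable[OF W[of 1]]
    by (simp only: first_period_integral integral_indicator_eq_cond_expect CO_1_events)
  moreover have "RF t = I 1 + (\<Sum>k=2..t. I k)"
    using tT reduced_form_eq[OF tT(3)]
    by (simp add: RF_def I_def sum.atLeast_Suc_atMost numeral_2_eq_2)
  \<comment> \<open>The target is now of the form \<open>(RF t - sum) / FS 1\<close>. All four
    bounds are brought to this form below, so that comparisons reduce to single summands.\<close>
  ultimately have \<Delta>C: "\<Delta>C = (RF t - (\<Sum>k=2..t. I k)) / FS 1"
    using c by (simp add: field_simps)
  have x_eq: "x k = e k True - e k False" if "k \<in> {2..t}" for k
  proof -
    have "k \<in> {1..T}" "k - 1 \<in> {1..T}" "2 \<le> k" "k \<le> T"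
      using that tT by auto
    then show ?thesis
      by (simp only: x_def FS_def first_stage_eq e_def prob_onset)
  qed
  have p_eq: "p z = (\<Sum>k=2..t. e k z)" for z
  proof -
    have "p z = \<P>(\<omega> in M. D t z \<omega>) - \<P>(\<omega> in M. D 1 z \<omega>)"
      unfolding p_def by (rule cond_prob_late_treatment[OF tT(3)])
    also have "\<dots> = (\<Sum>k=2..t. \<P>(\<omega> in M. D k z \<omega>) - \<P>(\<omega> in M. D (k - 1) z \<omega>))"
      using sum_telescope''[of 1 t "\<lambda>k. \<P>(\<omega> in M. D k z \<omega>)"] tT by (simp add: numeral_2_eq_2)
    also have "\<dots> = (\<Sum>k=2..t. e k z)"
      using tT by (intro sum.cong) (auto simp: e_def prob_onset)
    finally show ?thesis .
  qed
  have effect: "effect M Y0 Y1 t (t - k) g = cond_expect M (\<lambda>\<omega>. Y1 t (t - k) \<omega> - Y0 t \<omega>) g" for k g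
    by (simp add: effect_def)
  have I_bounds: "\<Delta>lo * e k True - \<Delta>hi * e k False \<le> I k" "I k \<le> \<Delta>hi * e k True - \<Delta>lo * e k False"
    if k: "k \<in> {2..t}" for k
  proof -
    have k': "2 \<le> k" "k \<le> T" and W': "integrable M (\<lambda>\<omega>. Y1 t (t - k) \<omega> - Y0 t \<omega>)"
      using k tT W[of k] by auto
    \<comment> \<open>The exposure is \<open>\<tau> = t - k\<close>: as \<open>k\<close> runs over
      \<open>{2..t}\<close>, it runs over \<open>{0..t - 2}\<close>, and
      \<open>t - \<tau> = k\<close>.\<close>
    have "\<Delta>lo \<le> effect M Y0 Y1 t (t - k) g \<and> effect M Y0 Y1 t (t - k) g \<le> \<Delta>hi"
      if "g \<in> groups M D k" "0 < prob g" for g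
      using bounds[of "t - k" g] that k by auto
    note switching_integral_bounds[OF k' W' bounds_sign this[unfolded effect]]
    then show "\<Delta>lo * e k True - \<Delta>hi * e k False \<le> I k" "I k \<le> \<Delta>hi * e k True - \<Delta>lo * e k False"
      unfolding I_def e_def by auto
  qed
  define L where "L = RF t / FS 1 + p False * (\<Delta>lo / FS 1) - p True * (\<Delta>hi / FS 1)"
  define U where "U = RF t / FS 1 + p False * (\<Delta>hi / FS 1) - p True * (\<Delta>lo / FS 1)"
  define S where "S = (\<Sum>k = 2..t. of_bool (FS (k - 1) < FS k) * ((FS (k - 1) - FS k) / FS 1))"
  define Ls where "Ls = RF t / FS 1 + \<Delta>lo * ((FS 1 - FS t) / FS 1) + (\<Delta>hi - \<Delta>lo) * S"
  define Us where "Us = RF t / FS 1 + \<Delta>hi * ((FS 1 - FS t) / FS 1) + (\<Delta>lo - \<Delta>hi) * S"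
  have L: "L = (RF t - (\<Sum>k=2..t. \<Delta>hi * e k True - \<Delta>lo * e k False)) / FS 1"
    by (simp add: L_def p_eq sum_subtractf sum_distrib_left[symmetric] diff_divide_distrib add_divide_distrib mult.commute)
  have U: "U = (RF t - (\<Sum>k=2..t. \<Delta>lo * e k True - \<Delta>hi * e k False)) / FS 1"
    by (simp add: U_def p_eq sum_subtractf sum_distrib_left[symmetric] diff_divide_distrib add_divide_distrib mult.commute)
  have S: "S = - (\<Sum>k=2..t. of_bool (0 < x k) * x k) / FS 1"
    unfolding S_def x_def sum_divide_distrib sum_negf[symmetric]
    by (intro sum.cong) (auto simp: diff_divide_distrib)
  have "FS t - FS 1 = (\<Sum>k=2..t. x k)"
    using sum_telescope''[of 1 t FS] tT by (simp add: x_def numeral_2_eq_2)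
  then have FS: "FS 1 - FS t = - (\<Sum>k=2..t. x k)"
    by linarith
  \<comment> \<open>\<open>FS 1 - FS t\<close> is minus the sum of all first-stage increments, and
    \<open>S\<close> collects minus the positive ones, divided by \<open>FS 1\<close>. Both sharper
    bounds are instances of this formula.\<close>
  have combine: "RF t / FS 1 + a * ((FS 1 - FS t) / FS 1) + b * S =
      (RF t - (\<Sum>k=2..t. a * x k + b * (of_bool (0 < x k) * x k))) / FS 1" for a b
    unfolding S FS sum.distrib sum_distrib_left[symmetric]
    by (simp add: diff_divide_distrib add_divide_distrib)
  note Ls = combine[of \<Delta>lo "\<Delta>hi - \<Delta>lo", folded Ls_def]
    and Us = combine[of \<Delta>hi "\<Delta>lo - \<Delta>hi", folded Us_def]
  \<comment> \<open>Dividing by the positive \<open>FS 1\<close> preserves order, while the sum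
    enters negatively: larger summands give smaller bounds.\<close>
  have mono: "(RF t - (\<Sum>k=2..t. f k)) / FS 1 \<le> (RF t - (\<Sum>k=2..t. g k)) / FS 1"
    if "\<And>k. k \<in> {2..t} \<Longrightarrow> g k \<le> f k" for f g :: "nat \<Rightarrow> real"
    using c that by (intro divide_right_mono diff_left_mono sum_mono) auto
  have "L \<le> \<Delta>C" "\<Delta>C \<le> U"
    unfolding L U \<Delta>C by (intro mono I_bounds; assumption)+
  moreover have "Ls \<le> \<Delta>C \<and> \<Delta>C \<le> Us \<and> L \<le> Ls \<and> Us \<le> U"
    if homog: "\<forall>\<tau>\<in>{0..t - 2}. \<forall>g\<in>groups M D (t - \<tau>). \<forall>g'\<in>groups M D (t - \<tau>).
      measure M g > 0 \<longrightarrow> measure M g' > 0 \<longrightarrow> effect M Y0 Y1 t \<tau> g = effect M Y0 Y1 t \<tau> g'"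
  proof -
    have delta: "\<exists>\<delta>. \<Delta>lo \<le> \<delta> \<and> \<delta> \<le> \<Delta>hi \<and> I k = \<delta> * x k" if k: "k \<in> {2..t}" for k
    proof -
      have tk: "t - k \<in> {0..t - 2}" "t - (t - k) = k" "2 \<le> k" "k \<le> T" "1 \<le> k"
        using k tT by auto
      have "\<exists>\<delta>. \<Delta>lo \<le> \<delta> \<and> \<delta> \<le> \<Delta>hi \<and>
        (\<forall>g\<in>groups M D k. 0 < prob g \<longrightarrow> effect M Y0 Y1 t (t - k) g = \<delta>)"
      proof (cases "\<exists>g\<in>groups M D k. 0 < prob g")
        case True
        then obtain g where g: "g \<in> groups M D k" "0 < prob g" by blast
        have "effect M Y0 Y1 t (t - k) g' = effect M Y0 Y1 t (t - k) g"
          if "g' \<in> groups M D k" "0 < prob g'" for g'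
          using homog[THEN bspec, OF tk(1), unfolded tk(2)] g that by blast
        then show ?thesis
          using bounds[OF tk(1), unfolded tk(2), OF g] by blast
      next
        case False
        then show ?thesis
          \<comment> \<open>If every group is null, there is no effect to choose; 0 serves as a
            default because it lies between \<open>\<Delta>lo\<close> and
            \<open>\<Delta>hi\<close>.\<close>
          using bounds_sign by (intro exI[of _ 0]) auto
      qed
      then obtain \<delta> where \<delta>: "\<Delta>lo \<le> \<delta>" "\<delta> \<le> \<Delta>hi"
        "\<And>g. g \<in> groups M D k \<Longrightarrow> 0 < prob g \<Longrightarrow> effect M Y0 Y1 t (t - k) g = \<delta>"
        by blast
      have "I k = \<delta> * x k"
        using switching_integral_homogeneous[OF tk(3,4) W[OF tk(5)], of \<delta>] \<delta>(3) k
        by (simp add: I_def x_eq e_def effect)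
      with \<delta> show ?thesis
        by blast
    qed
    \<comment> \<open>The left side is \<open>\<Delta>lo * x k\<close> for a positive increment and
      \<open>\<Delta>hi * x k\<close> otherwise; the right side has the two constants exchanged.
      These are the extreme values of \<open>\<delta> * x k\<close> for \<delta> between the
      constants.\<close>
    have cmp: "\<Delta>hi * x k + (\<Delta>lo - \<Delta>hi) * (of_bool (0 < x k) * x k) \<le> I k \<and>
        I k \<le> \<Delta>lo * x k + (\<Delta>hi - \<Delta>lo) * (of_bool (0 < x k) * x k)" if k: "k \<in> {2..t}" for k
    proof -
      obtain \<delta> where "\<Delta>lo \<le> \<delta>" "\<delta> \<le> \<Delta>hi" "I k = \<delta> * x k"
        using delta[OF k] by blast
      then show ?thesis
        by (cases "0 < x k") (auto simp: algebra_simps intro: mult_right_mono mult_right_mono_neg)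
    qed
    \<comment> \<open>With \<open>x k = e k True - e k False\<close>, each comparison loses exactly
      a term \<open>(\<Delta>hi - \<Delta>lo) * e k z\<close>, where \<open>z\<close> depends on the
      sign of the increment. This term is nonnegative, so the homogeneous bounds are the tighter
      ones.\<close>
    have cmp': "\<Delta>lo * x k + (\<Delta>hi - \<Delta>lo) * (of_bool (0 < x k) * x k) \<le> \<Delta>hi * e k True - \<Delta>lo * e k False \<and>
        \<Delta>lo * e k True - \<Delta>hi * e k False \<le> \<Delta>hi * x k + (\<Delta>lo - \<Delta>hi) * (of_bool (0 < x k) * x k)"
      if "k \<in> {2..t}" for k
    proof -
      have "\<Delta>lo * e k z \<le> \<Delta>hi * e k z" for z
        using bounds_sign by (intro mult_right_mono) (auto simp: e_def)
      from this[of True] this[of False] show ?thesis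
        by (cases "0 < x k") (simp_all add: x_eq[OF that] algebra_simps)
    qed
    show ?thesis
      unfolding Ls Us L U \<Delta>C using cmp cmp' by (intro conjI mono) blast+
  qed
  moreover have "\<P>(\<omega> in M. obs_treat Z D t \<omega> > obs_treat Z D 1 \<omega> \<bar> Z \<omega>) = p True"
      "\<P>(\<omega> in M. obs_treat Z D t \<omega> > obs_treat Z D 1 \<omega> \<bar> \<not> Z \<omega>) = p False"
    by (simp_all add: p_def)
  ultimately show ?thesis
    unfolding Let_def L_def U_def Ls_def Us_def S_def RF_def FS_def \<Delta>C_def by (simp only:) blast
qed

end
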